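(* Let $\kappa$ be a field, let $S'$ be a positive affine semigroup and let $S\subseteq S'$ be an affine subsemigroup (submonoid). Put $R=\kappa[\mathbf{u}^{S}]\subseteq R'=\kappa[\mathbf{u}^{S'}]$. The following conditions are equivalent. (i) Every monomial in $R'$ has a unique representation over $R$. (ii) $R'$ is free over $R$ (as an $R$-module). (iii) $R'$ is flat over $R$.
   Context: Monoids are commutative, written additively with identity $0$. An affine semigroup is a finitely generated monoid that is cancellative and torsion free ($ns_1=ns_2$ for some positive integer $n$ implies $s_1=s_2$); equivalently, a finitely generated monoid embeddable in some $\mathbb{Z}^d$. It is positive if $0$ is its only invertible element. For an affine semigroup $S'$, $\kappa[\mathbf{u}^{S'}]$ is the monoid ring: the $\kappa$-vector space with basis the monomials $\mathbf{u}^{s}$, $s\in S'$, with $\mathbf{u}^s\mathbf{u}^t=\mathbf{u}^{s+t}$. A monomial $\mathbf{u}^w\in R'$ is Apéry over $R$ if it cannot be written as $\mathbf{u}^s\mathbf{u}^{w_0}$ with $\mathbf{u}^{w_0}$ a monomial in $R'$ (i.e. $w_0\in S'$) and $1\neq\mathbf{u}^s$ a monomial in $R$ (i.e. $0\ne s\in S$). A representation of a monomial $\mathbf{u}^{s'}\in R'$ over $R$ is an expression $\mathbf{u}^{s'}=\mathbf{u}^s\mathbf{u}^w$ with $\mathbf{u}^s$ a monomial in $R$ and $\mathbf{u}^w$ an Apéry monomial of $R'$ over $R$. *)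

theory Defs
  imports HOL.Hull "HOL-Algebra.Module" "HOL-Algebra.Generated_Groups" "HOL-Algebra.Free_Abelian_Groups"
begin

section \<open>Affine semigroups\<close>

text \<open>Monoids are submonoids of an arbitrary additive commutative monoid, which is itself not
  assumed cancellative or torsion free. The sum of a constant below is the multiple n s.\<close>

definition add_submonoid :: "'s::comm_monoid_add set \<Rightarrow> bool" where
  "add_submonoid S \<longleftrightarrow> 0 \<in> S \<and> (\<forall>x\<in>S. \<forall>y\<in>S. x + y \<in> S)"

definition affine_semigroup :: "'s::comm_monoid_add set \<Rightarrow> bool" where
  "affine_semigroup S \<longleftrightarrow>
     add_submonoid S \<and>
     (\<exists>G. finite G \<and> G \<subseteq> S \<and> add_submonoid hull G = S) \<and>
     (\<forall>a\<in>S. \<forall>x\<in>S. \<forall>y\<in>S. a + x = a + y \<longrightarrow> x = y) \<and>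
     (\<forall>n::nat. \<forall>x\<in>S. \<forall>y\<in>S. n > 0 \<and> (\<Sum>i<n. x) = (\<Sum>i<n. y) \<longrightarrow> x = y)"

definition positive_monoid :: "'s::comm_monoid_add set \<Rightarrow> bool" where
  "positive_monoid S \<longleftrightarrow> (\<forall>x\<in>S. (\<exists>y\<in>S. x + y = 0) \<longrightarrow> x = 0)"


section \<open>Monoid rings\<close>

text \<open>The product and unit of \<^typ>\<open>'s \<Rightarrow>\<^sub>0 'k\<close> are the convolution product and the monomial of
  exponent 0, so the elements supported in a submonoid \<open>S\<close> form the monoid ring of \<open>S\<close>.\<close>

definition monoid_ring :: "'s::comm_monoid_add set \<Rightarrow> ('s \<Rightarrow>\<^sub>0 'k::field) ring" where
  "monoid_ring S =
     \<lparr>carrier = {f. Poly_Mapping.keys f \<subseteq> S}, monoid.mult = (*), one = 1, ring.zero = 0, ring.add = (+)\<rparr>"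

text \<open>A ring as a module over a subring, with the multiplication of the big ring as scalar
  multiplication.\<close>

definition ring_as_module :: "'a ring \<Rightarrow> ('a, 'a) module" where
  "ring_as_module A =
     \<lparr>carrier = carrier A, monoid.mult = monoid.mult A, one = one A,
      ring.zero = ring.zero A, ring.add = ring.add A, smult = monoid.mult A\<rparr>"

definition monomials :: "'s::comm_monoid_add set \<Rightarrow> ('s \<Rightarrow>\<^sub>0 'k::field) set" where
  "monomials S = (\<lambda>s. Poly_Mapping.single s 1) ` S"

definition apery_monomial ::
    "'s::comm_monoid_add set \<Rightarrow> 's set \<Rightarrow> ('s \<Rightarrow>\<^sub>0 'k::field) \<Rightarrow> bool" where
  "apery_monomial S S' w \<longleftrightarrow>
     w \<in> monomials S' \<and> \<not> (\<exists>m\<in>monomials S. \<exists>w0\<in>monomials S'. m \<noteq> 1 \<and> w = m * w0)"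

definition is_representation ::
    "'s::comm_monoid_add set \<Rightarrow> 's set \<Rightarrow> ('s \<Rightarrow>\<^sub>0 'k::field) \<Rightarrow>
      ('s \<Rightarrow>\<^sub>0 'k) \<times> ('s \<Rightarrow>\<^sub>0 'k) \<Rightarrow> bool" where
  "is_representation S S' x = (\<lambda>(m, w). m \<in> monomials S \<and> apery_monomial S S' w \<and> x = m * w)"


section \<open>Free modules\<close>

definition module_basis :: "('r, 'x) ring_scheme \<Rightarrow> ('r, 'p, 'y) module_scheme \<Rightarrow> 'p set \<Rightarrow> bool"
  where
  "module_basis R P B \<longleftrightarrow>
     B \<subseteq> carrier P \<and>
     (\<forall>x\<in>carrier P. \<exists>F c. finite F \<and> F \<subseteq> B \<and> c \<in> F \<rightarrow> carrier R \<and>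
        x = (\<Oplus>\<^bsub>P\<^esub>b\<in>F. c b \<odot>\<^bsub>P\<^esub> b)) \<and>
     (\<forall>F c. finite F \<and> F \<subseteq> B \<and> c \<in> F \<rightarrow> carrier R \<and>
        (\<Oplus>\<^bsub>P\<^esub>b\<in>F. c b \<odot>\<^bsub>P\<^esub> b) = \<zero>\<^bsub>P\<^esub> \<longrightarrow> (\<forall>b\<in>F. c b = \<zero>\<^bsub>R\<^esub>))"

definition free_module :: "('r, 'x) ring_scheme \<Rightarrow> ('r, 'p, 'y) module_scheme \<Rightarrow> bool" where
  "free_module R P \<longleftrightarrow> module R P \<and> (\<exists>B. module_basis R P B)"


section \<open>Tensor products and flat modules\<close>

definition linear_maps ::
    "('r, 'x) ring_scheme \<Rightarrow> ('r, 'm, 'y) module_scheme \<Rightarrow> ('r, 'n, 'z) module_scheme \<Rightarrow> ('m \<Rightarrow> 'n) set"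
  where
  "linear_maps R M N =
     {f. f \<in> carrier M \<rightarrow> carrier N \<and>
         (\<forall>x\<in>carrier M. \<forall>y\<in>carrier M. f (x \<oplus>\<^bsub>M\<^esub> y) = f x \<oplus>\<^bsub>N\<^esub> f y) \<and>
         (\<forall>a\<in>carrier R. \<forall>x\<in>carrier M. f (a \<odot>\<^bsub>M\<^esub> x) = a \<odot>\<^bsub>N\<^esub> f x)}"

text \<open>The tensor product over a commutative ring: the free abelian group on the pairs, modulo
  the subgroup generated by the bilinearity and balancing relations.\<close>

definition tensor_relators ::
    "('r, 'x) ring_scheme \<Rightarrow> ('r, 'p, 'y) module_scheme \<Rightarrow> ('r, 'm, 'z) module_scheme \<Rightarrow>
      ('p \<times> 'm \<Rightarrow>\<^sub>0 int) set" where
  "tensor_relators R P M =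
     {frag_of (p \<oplus>\<^bsub>P\<^esub> q, x) - frag_of (p, x) - frag_of (q, x) |p q x.
        p \<in> carrier P \<and> q \<in> carrier P \<and> x \<in> carrier M} \<union>
     {frag_of (p, x \<oplus>\<^bsub>M\<^esub> y) - frag_of (p, x) - frag_of (p, y) |p x y.
        p \<in> carrier P \<and> x \<in> carrier M \<and> y \<in> carrier M} \<union>
     {frag_of (a \<odot>\<^bsub>P\<^esub> p, x) - frag_of (p, a \<odot>\<^bsub>M\<^esub> x) |a p x.
        a \<in> carrier R \<and> p \<in> carrier P \<and> x \<in> carrier M}"

definition tensor_kernel ::
    "('r, 'x) ring_scheme \<Rightarrow> ('r, 'p, 'y) module_scheme \<Rightarrow> ('r, 'm, 'z) module_scheme \<Rightarrow>
      ('p \<times> 'm \<Rightarrow>\<^sub>0 int) set" where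
  "tensor_kernel R P M =
     generate (free_Abelian_group (carrier P \<times> carrier M)) (tensor_relators R P M)"

definition tensor_product ::
    "('r, 'x) ring_scheme \<Rightarrow> ('r, 'p, 'y) module_scheme \<Rightarrow> ('r, 'm, 'z) module_scheme \<Rightarrow>
      ('p \<times> 'm \<Rightarrow>\<^sub>0 int) set monoid" where
  "tensor_product R P M =
     free_Abelian_group (carrier P \<times> carrier M) Mod tensor_kernel R P M"

text \<open>The map \<open>id \<otimes> f\<close> from \<open>P \<otimes> M\<close> to \<open>P \<otimes> N\<close>, on cosets; it does not depend on the
  chosen representative, see \<open>tensor_map_coset\<close> below.\<close>

definition tensor_map ::
    "('r, 'x) ring_scheme \<Rightarrow> ('r, 'p, 'y) module_scheme \<Rightarrow> ('r, 'm, 'z) module_scheme \<Rightarrow>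
      ('r, 'n, 'w) module_scheme \<Rightarrow> ('m \<Rightarrow> 'n) \<Rightarrow>
      ('p \<times> 'm \<Rightarrow>\<^sub>0 int) set \<Rightarrow> ('p \<times> 'n \<Rightarrow>\<^sub>0 int) set" where
  "tensor_map R P M N f X =
     the_elem ((\<lambda>t. tensor_kernel R P N #>\<^bsub>free_Abelian_group (carrier P \<times> carrier N)\<^esub>
        frag_extend (\<lambda>(p, x). frag_of (p, f x)) t) ` X)"

text \<open>\<open>P\<close> is flat if tensoring with \<open>P\<close> preserves injectivity of linear maps \<open>M \<rightarrow> N\<close>. In HOL the
  modules \<open>M\<close> and \<open>N\<close> have to range over a fixed type. It is \<^typ>\<open>'r + 'u\<close>, with \<open>'u\<close> arbitrary:
  every type of modules is reached by some \<open>'u\<close>, while the summand \<open>'r\<close> provides all ideals of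
  \<open>R\<close>. As flatness can be tested on inclusions of ideals, the truth value is the same for all \<open>'u\<close>.\<close>

definition flat_module ::
    "'u itself \<Rightarrow> ('r, 'x) ring_scheme \<Rightarrow> ('r, 'p, 'y) module_scheme \<Rightarrow> bool" where
  "flat_module U R P \<longleftrightarrow>
     module R P \<and>
     (\<forall>(M :: ('r, 'r + 'u) module) (N :: ('r, 'r + 'u) module) f.
        module R M \<and> module R N \<and> f \<in> linear_maps R M N \<and> inj_on f (carrier M) \<longrightarrow>
        inj_on (tensor_map R P M N f) (carrier (tensor_product R P M)))"


section \<open>Consistency of the definitions\<close>

lemma module_monoid_ring:
  assumes "add_submonoid S" "add_submonoid S'" "S \<subseteq> S'"
  shows "module (monoid_ring S :: ('s::comm_monoid_add \<Rightarrow>\<^sub>0 'k::field) ring)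
           (ring_as_module (monoid_ring S'))"
proof -
  have mult: "Poly_Mapping.keys (f * g) \<subseteq> T"
    if "add_submonoid T" "Poly_Mapping.keys f \<subseteq> T" "Poly_Mapping.keys g \<subseteq> T"
    for T and f g :: "'s \<Rightarrow>\<^sub>0 'k"
    using that keys_mult[of f g] unfolding add_submonoid_def by blast
  have add: "Poly_Mapping.keys (f + g) \<subseteq> T"
    if "Poly_Mapping.keys f \<subseteq> T" "Poly_Mapping.keys g \<subseteq> T" for T and f g :: "'s \<Rightarrow>\<^sub>0 'k"
    using that Poly_Mapping.keys_add[of f g] by blast
  have zero: "0 \<in> T" if "add_submonoid T" for T :: "'s set"
    using that by (simp add: add_submonoid_def)
  have group: "abelian_group (monoid_ring T :: ('s \<Rightarrow>\<^sub>0 'k) ring)" for T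
  proof (rule abelian_groupI)
    fix x :: "'s \<Rightarrow>\<^sub>0 'k"
    assume "x \<in> carrier (monoid_ring T)"
    then show "\<exists>y\<in>carrier (monoid_ring T). y \<oplus>\<^bsub>monoid_ring T\<^esub> x = \<zero>\<^bsub>monoid_ring T\<^esub>"
      by (intro bexI[of _ "- x"]) (simp_all add: monoid_ring_def)
  qed (simp_all add: monoid_ring_def add add.assoc add.commute)
  have cring: "cring (monoid_ring T :: ('s \<Rightarrow>\<^sub>0 'k) ring)" if "add_submonoid T" for T
    by (intro cringI group comm_monoidI)
      (simp_all add: monoid_ring_def mult zero that mult.assoc mult.commute distrib_left distrib_right)
  have group': "abelian_group (ring_as_module (monoid_ring T :: ('s \<Rightarrow>\<^sub>0 'k) ring))" for T
  proof (rule abelian_groupI)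
    fix x :: "'s \<Rightarrow>\<^sub>0 'k"
    assume "x \<in> carrier (ring_as_module (monoid_ring T))"
    then show "\<exists>y\<in>carrier (ring_as_module (monoid_ring T)).
        y \<oplus>\<^bsub>ring_as_module (monoid_ring T)\<^esub> x = \<zero>\<^bsub>ring_as_module (monoid_ring T)\<^esub>"
      by (intro bexI[of _ "- x"]) (simp_all add: monoid_ring_def ring_as_module_def)
  qed (simp_all add: monoid_ring_def ring_as_module_def add add.assoc add.commute)
  have sub: "Poly_Mapping.keys (f * g) \<subseteq> S'"
    if "Poly_Mapping.keys f \<subseteq> S" "Poly_Mapping.keys g \<subseteq> S'" for f g :: "'s \<Rightarrow>\<^sub>0 'k"
    using that assms by (intro mult) auto
  show ?thesis
    by (intro moduleI cring group' assms)
      (simp_all add: monoid_ring_def ring_as_module_def sub mult.assoc distrib_left distrib_right)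
qed

lemma tensor_kernel_map:
  assumes M: "module R M" and N: "module R N" and f: "f \<in> linear_maps R M N"
    and P: "module R P" and h: "h \<in> tensor_kernel R P M"
  shows "frag_extend (\<lambda>(p, x). frag_of (p, f x)) h \<in> tensor_kernel R P N"
proof -
  interpret M: module R M by fact
  interpret N: module R N by fact
  interpret P: module R P by fact
  let ?\<phi> = "frag_extend (\<lambda>(p, x). frag_of (p, f x))"
  let ?G = "free_Abelian_group (carrier P \<times> carrier M)"
  let ?H = "free_Abelian_group (carrier P \<times> carrier N)"
  have carr: "x \<in> carrier M \<Longrightarrow> f x \<in> carrier N" for x
    using f by (auto simp: linear_maps_def)
  have subM: "tensor_relators R P M \<subseteq> carrier ?G"
    unfolding tensor_relators_def free_Abelian_group_def
    by (auto dest!: subsetD[OF keys_diff])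
  have subN: "tensor_relators R P N \<subseteq> carrier ?H"
    unfolding tensor_relators_def free_Abelian_group_def
    by (auto dest!: subsetD[OF keys_diff])
  have sg: "subgroup (tensor_kernel R P N) ?H"
    unfolding tensor_kernel_def by (rule group.generate_is_subgroup) (simp_all add: subN)
  have rel: "?\<phi> r \<in> tensor_relators R P N" if "r \<in> tensor_relators R P M" for r
  proof -
    have "(\<exists>p q x. r = frag_of (p \<oplus>\<^bsub>P\<^esub> q, x) - frag_of (p, x) - frag_of (q, x) \<and>
             p \<in> carrier P \<and> q \<in> carrier P \<and> x \<in> carrier M) \<or>
          (\<exists>p x y. r = frag_of (p, x \<oplus>\<^bsub>M\<^esub> y) - frag_of (p, x) - frag_of (p, y) \<and>
             p \<in> carrier P \<and> x \<in> carrier M \<and> y \<in> carrier M) \<or>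
          (\<exists>a p x. r = frag_of (a \<odot>\<^bsub>P\<^esub> p, x) - frag_of (p, a \<odot>\<^bsub>M\<^esub> x) \<and>
             a \<in> carrier R \<and> p \<in> carrier P \<and> x \<in> carrier M)"
      using that unfolding tensor_relators_def by blast
    then show ?thesis
    proof (elim disjE exE conjE)
      fix p q x
      assume r: "r = frag_of (p \<oplus>\<^bsub>P\<^esub> q, x) - frag_of (p, x) - frag_of (q, x)"
        and c: "p \<in> carrier P" "q \<in> carrier P" "x \<in> carrier M"
      have "?\<phi> r = frag_of (p \<oplus>\<^bsub>P\<^esub> q, f x) - frag_of (p, f x) - frag_of (q, f x)"
        by (simp add: r frag_extend_diff)
      then show ?thesis using c carr unfolding tensor_relators_def by blast
    next
      fix p x y
      assume r: "r = frag_of (p, x \<oplus>\<^bsub>M\<^esub> y) - frag_of (p, x) - frag_of (p, y)"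
        and c: "p \<in> carrier P" "x \<in> carrier M" "y \<in> carrier M"
      have "f (x \<oplus>\<^bsub>M\<^esub> y) = f x \<oplus>\<^bsub>N\<^esub> f y" using f c by (auto simp: linear_maps_def)
      then have "?\<phi> r = frag_of (p, f x \<oplus>\<^bsub>N\<^esub> f y) - frag_of (p, f x) - frag_of (p, f y)"
        by (simp add: r frag_extend_diff)
      then show ?thesis using c carr unfolding tensor_relators_def by blast
    next
      fix a p x
      assume r: "r = frag_of (a \<odot>\<^bsub>P\<^esub> p, x) - frag_of (p, a \<odot>\<^bsub>M\<^esub> x)"
        and c: "a \<in> carrier R" "p \<in> carrier P" "x \<in> carrier M"
      have "f (a \<odot>\<^bsub>M\<^esub> x) = a \<odot>\<^bsub>N\<^esub> f x" using f c by (auto simp: linear_maps_def)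
      then have "?\<phi> r = frag_of (a \<odot>\<^bsub>P\<^esub> p, f x) - frag_of (p, a \<odot>\<^bsub>N\<^esub> f x)"
        by (simp add: r frag_extend_diff)
      then show ?thesis using c carr unfolding tensor_relators_def by blast
    qed
  qed
  from h show ?thesis
    unfolding tensor_kernel_def
  proof (induction rule: generate.induct)
    case one
    show ?case using generate.one[of ?H] by simp
  next
    case (incl h)
    then show ?case by (intro generate.incl rel)
  next
    case (inv h)
    have "Poly_Mapping.keys h \<subseteq> carrier P \<times> carrier M"
      using inv subM by (auto simp: free_Abelian_group_def)
    then have "inv\<^bsub>?G\<^esub> h = - h" by simp
    moreover have "Poly_Mapping.keys (?\<phi> h) \<subseteq> carrier P \<times> carrier N"
      using rel[OF inv] subN by (auto simp: free_Abelian_group_def)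
    then have "inv\<^bsub>?H\<^esub> (?\<phi> h) = - ?\<phi> h" by simp
    ultimately show ?case
      using generate.inv[OF rel[OF inv], of ?H] by (simp add: frag_extend_minus)
  next
    case (eng h1 h2)
    then show ?case using generate.eng[OF eng.IH] by (simp add: frag_extend_add)
  qed
qed

lemma tensor_map_coset:
  assumes M: "module R M" and N: "module R N" and f: "f \<in> linear_maps R M N"
    and P: "module R P"
    and t: "t \<in> carrier (free_Abelian_group (carrier P \<times> carrier M))"
  shows "tensor_map R P M N f
           (tensor_kernel R P M #>\<^bsub>free_Abelian_group (carrier P \<times> carrier M)\<^esub> t) =
         tensor_kernel R P N #>\<^bsub>free_Abelian_group (carrier P \<times> carrier N)\<^esub>
           frag_extend (\<lambda>(p, x). frag_of (p, f x)) t"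
proof -
  interpret N: module R N by fact
  interpret P: module R P by fact
  let ?\<phi> = "frag_extend (\<lambda>(p, x). frag_of (p, f x))"
  let ?G = "free_Abelian_group (carrier P \<times> carrier M)"
  let ?H = "free_Abelian_group (carrier P \<times> carrier N)"
  let ?K = "tensor_kernel R P M" and ?L = "tensor_kernel R P N"
  have "tensor_relators R P N \<subseteq> carrier ?H"
    unfolding tensor_relators_def free_Abelian_group_def
    by (auto dest!: subsetD[OF keys_diff])
  then have sg: "subgroup ?L ?H"
    unfolding tensor_kernel_def by (intro group.generate_is_subgroup) simp_all
  have carr: "?\<phi> t \<in> carrier ?H"
  proof -
    have "Poly_Mapping.keys (?\<phi> t) \<subseteq>
            (\<Union>z\<in>Poly_Mapping.keys t. Poly_Mapping.keys (case z of (p, x) \<Rightarrow> frag_of (p, f x)))"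
      by (rule keys_frag_extend)
    also have "\<dots> \<subseteq> carrier P \<times> carrier N"
      using t f by (fastforce simp: free_Abelian_group_def linear_maps_def)
    finally show ?thesis by (simp add: free_Abelian_group_def)
  qed
  have eq: "?L #>\<^bsub>?H\<^esub> ?\<phi> (h + t) = ?L #>\<^bsub>?H\<^esub> ?\<phi> t" if "h \<in> ?K" for h
  proof -
    have hL: "?\<phi> h \<in> ?L" by (rule tensor_kernel_map[OF M N f P that])
    have LH: "?L \<subseteq> carrier ?H" using sg by (rule subgroup.subset)
    have "?L #>\<^bsub>?H\<^esub> ?\<phi> (h + t) = (?L #>\<^bsub>?H\<^esub> ?\<phi> h) #>\<^bsub>?H\<^esub> ?\<phi> t"
      using group.coset_mult_assoc[OF group_free_Abelian_group LH subsetD[OF LH hL] carr]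
      by (simp add: frag_extend_add)
    also have "?L #>\<^bsub>?H\<^esub> ?\<phi> h = ?L"
      using group.coset_join2[OF group_free_Abelian_group subsetD[OF LH hL] sg hL] .
    finally show ?thesis .
  qed
  have "(0 :: _ \<Rightarrow>\<^sub>0 int) \<in> ?K"
    using generate.one[of ?G "tensor_relators R P M"] by (simp add: tensor_kernel_def)
  then have "(\<lambda>t. ?L #>\<^bsub>?H\<^esub> ?\<phi> t) ` (?K #>\<^bsub>?G\<^esub> t) = {?L #>\<^bsub>?H\<^esub> ?\<phi> t}"
    using eq by (auto simp: r_coset_def image_UN)
  then show ?thesis by (simp add: tensor_map_def)
qed

end

theory Submission
  imports Defs "HOL-Library.Ramsey"
begin

text \<open>Write \<open>\<kappa>[T]\<close> for the monoid ring of the big monoid \<open>T\<close> and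
  \<open>\<kappa>[S]\<close> for that of \<open>S\<close>. Multiplying monomials adds exponents, so
  representations are decompositions \<open>x = s + w\<close> of exponents, with \<open>s\<close> in
  \<open>S\<close> and \<open>w\<close> not divisible in \<open>T\<close> by a nonzero element of
  \<open>S\<close>. They always exist, since proper divisibility in a positive affine semigroup is
  well-founded (\<open>wf_proper_divisor\<close>). The condition that every monomial has a unique
  representation is therefore about uniqueness alone (\<open>unique_representation_iff\<close>), and the
  equivalence is a cycle of three implications.

  Uniqueness implies freeness: if decompositions are unique, every monomial of \<open>\<kappa>[T]\<close> is
  in exactly one way an \<open>S\<close>-monomial times an Apery monomial. Hence the Apery monomials form a
  basis (\<open>apery_monomials_basis\<close>).

  Freeness implies flatness: free modules over any commutative ring are flat (\<open>free_imp_flat\<close>).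
  If \<open>B\<close> is a basis of \<open>P\<close>, an element of \<open>P \<otimes> M\<close> is a sum of
  tensors \<open>b \<otimes> m\<^sub>b\<close> (\<open>tensor_normal_form\<close>), which the coordinate
  functions of \<open>B\<close> recover (\<open>tensor_kernel_basis_sum\<close>); a map \<open>f\<close> acts
  by \<open>m\<^sub>b \<mapsto> f m\<^sub>b\<close>, so injectivity is inherited.

  Flatness implies uniqueness: suppose \<open>s\<^sub>1 + w\<^sub>1 = s\<^sub>2 + w\<^sub>2\<close> with
  \<open>w\<^sub>1\<close> and \<open>w\<^sub>2\<close> Apery. Let \<open>I\<close> be the ideal of
  \<open>\<kappa>[S]\<close> generated by the monomials \<open>u^s\<^sub>1\<close> and
  \<open>u^s\<^sub>2\<close>. The tensor \<open>u^w\<^sub>1 \<otimes> u^s\<^sub>1 - u^w\<^sub>2 \<otimes>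
  u^s\<^sub>2\<close> vanishes in \<open>\<kappa>[T] \<otimes> \<kappa>[S]\<close>, so by flatness it vanishes
  in \<open>\<kappa>[T] \<otimes> I\<close>. But if \<open>s\<^sub>2\<close> did not divide
  \<open>s\<^sub>1\<close> in \<open>S\<close>, then \<open>u^s\<^sub>1\<close> would be a minimal generator
  of \<open>I\<close>, just as \<open>u^w\<^sub>1\<close> is one of \<open>\<kappa>[T]\<close>; multiplying
  the two corresponding coefficients would give a balanced map \<open>\<kappa>[T] \<times> I \<rightarrow>
  \<kappa>\<close> with value 1 on the tensor. So \<open>s\<^sub>1 = s\<^sub>2 + t\<close> with
  \<open>t\<close> in \<open>S\<close> (\<open>flat_imp_dvd\<close>). Cancelling \<open>s\<^sub>2\<close>
  leaves \<open>t + w\<^sub>1 = w\<^sub>2\<close>, and \<open>t = 0\<close> because \<open>w\<^sub>2\<close>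
  is Apery.\<close>

section \<open>Decompositions into Apery elements\<close>

lemma sum_const_add:
  fixes x :: "'s::comm_monoid_add"
  shows "(\<Sum>i<m + n. x) = (\<Sum>i<m. x) + (\<Sum>i<n::nat. x)"
  by (induction n) (simp_all add: add_ac)

lemma hull_combination:
  fixes G :: "'s::comm_monoid_add set"
  assumes "finite G" and "x \<in> add_submonoid hull G"
  shows "\<exists>n :: 's \<Rightarrow> nat. x = (\<Sum>g\<in>G. \<Sum>i<n g. g)"
  using assms(2)
proof (rule hull_induct)
  fix g assume "g \<in> G"
  have "(\<Sum>h\<in>G. \<Sum>i<(if h = g then 1 else 0::nat). h) = (\<Sum>h\<in>G. if h = g then h else 0)"
    by (rule sum.cong) auto
  also have "\<dots> = g" using \<open>g \<in> G\<close> \<open>finite G\<close> by simp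
  finally show "\<exists>n :: 's \<Rightarrow> nat. g = (\<Sum>g\<in>G. \<Sum>i<n g. g)" by metis
next
  show "add_submonoid {x. \<exists>n :: 's \<Rightarrow> nat. x = (\<Sum>g\<in>G. \<Sum>i<n g. g)}"
    unfolding add_submonoid_def
  proof (intro conjI ballI)
    show "0 \<in> {x. \<exists>n :: 's \<Rightarrow> nat. x = (\<Sum>g\<in>G. \<Sum>i<n g. g)}"
      by (auto intro!: exI[of _ "\<lambda>_. 0"])
  next
    fix x y assume "x \<in> {x. \<exists>n :: 's \<Rightarrow> nat. x = (\<Sum>g\<in>G. \<Sum>i<n g. g)}"
      and "y \<in> {x. \<exists>n :: 's \<Rightarrow> nat. x = (\<Sum>g\<in>G. \<Sum>i<n g. g)}"
    then obtain m n :: "'s \<Rightarrow> nat" where "x = (\<Sum>g\<in>G. \<Sum>i<m g. g)" "y = (\<Sum>g\<in>G. \<Sum>i<n g. g)"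
      by blast
    then have "x + y = (\<Sum>g\<in>G. \<Sum>i<m g + n g. g)"
      by (simp add: sum_const_add sum.distrib)
    then show "x + y \<in> {x. \<exists>n :: 's \<Rightarrow> nat. x = (\<Sum>g\<in>G. \<Sum>i<n g. g)}"
      by (auto intro!: exI[of _ "\<lambda>g. m g + n g"])
  qed
qed

lemma submonoid_sum:
  assumes "add_submonoid T" and "\<And>i. i \<in> I \<Longrightarrow> f i \<in> T"
  shows "sum f I \<in> T"
  using assms(2)
  by (induction I rule: infinite_finite_induct) (use assms(1) in \<open>auto simp: add_submonoid_def\<close>)

definition proper_divisor :: "'s::comm_monoid_add set \<Rightarrow> ('s \<times> 's) set" where
  "proper_divisor T = {(y, x). y \<in> T \<and> x \<in> T \<and> (\<exists>s\<in>T. s \<noteq> 0 \<and> x = s + y)}"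

text \<open>A termination argument in place of Dickson's lemma. Fix a coordinate vector with respect to
  finitely many generators for each element. A proper divisor \<open>y\<close> of \<open>x\<close> must have a smaller entry
  than \<open>x\<close> in some coordinate: otherwise \<open>x\<close> would divide \<open>y\<close>, and cancellation would turn the
  quotients into inverse units. So the transitive relation of proper divisibility is covered by
  finitely many well-founded relations, one for each generator, and is itself well-founded by
  Ramsey's theorem.\<close>

lemma wf_proper_divisor:
  fixes T :: "'s::comm_monoid_add set"
  assumes aff: "affine_semigroup T" and pos: "positive_monoid T"
  shows "wf (proper_divisor T)"
proof -
  let ?r = "proper_divisor T"
  have sub: "add_submonoid T"
    and cancel: "\<And>a x y. a \<in> T \<Longrightarrow> x \<in> T \<Longrightarrow> y \<in> T \<Longrightarrow> a + x = a + y \<Longrightarrow> x = y"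
    using aff by (auto simp: affine_semigroup_def)
  have zero: "0 \<in> T" and add: "\<And>x y. x \<in> T \<Longrightarrow> y \<in> T \<Longrightarrow> x + y \<in> T"
    using sub by (auto simp: add_submonoid_def)
  have unit: "x = 0" if "x \<in> T" "y \<in> T" "x + y = 0" for x y
    using pos that by (auto simp: positive_monoid_def)
  obtain G where G: "finite G" "G \<subseteq> T" "add_submonoid hull G = T"
    using aff by (auto simp: affine_semigroup_def)
  have "\<exists>n :: 's \<Rightarrow> nat. x = (\<Sum>g\<in>G. \<Sum>i<n g. g)" if "x \<in> T" for x
    using hull_combination[OF G(1)] G(3) that by blast
  then obtain n :: "'s \<Rightarrow> 's \<Rightarrow> nat" where n: "\<And>x. x \<in> T \<Longrightarrow> x = (\<Sum>g\<in>G. \<Sum>i<n x g. g)"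
    by metis
  \<comment> \<open>The case in which no coordinate drops: \<open>y = x + m\<close>, so \<open>x = s + x + m\<close> and \<open>s + m = 0\<close>.\<close>
  have drop: "\<exists>g\<in>G. n y g < n x g" if "(y, x) \<in> ?r" for x y
  proof (rule ccontr)
    assume "\<not> ?thesis"
    then have le: "\<And>g. g \<in> G \<Longrightarrow> n x g \<le> n y g" by (auto simp: not_less)
    from that obtain s where s: "s \<in> T" "s \<noteq> 0" "x = s + y" and xy: "x \<in> T" "y \<in> T"
      by (auto simp: proper_divisor_def)
    define m where "m = (\<Sum>g\<in>G. \<Sum>i<n y g - n x g. g)"
    have mT: "m \<in> T" unfolding m_def using G(2) by (intro submonoid_sum sub) auto
    have "y = (\<Sum>g\<in>G. \<Sum>i<n y g. g)" by (rule n[OF xy(2)])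
    also have "\<dots> = (\<Sum>g\<in>G. \<Sum>i<n x g + (n y g - n x g). g)"
      using le by (intro sum.cong) auto
    also have "\<dots> = x + m"
      unfolding m_def by (subst (2) n[OF xy(1)]) (simp only: sum_const_add sum.distrib)
    finally have "x + (s + m) = x + 0" using s(3) by (simp add: add_ac)
    then have "s + m = 0" using cancel[of x "s + m" 0] add s(1) mT xy(1) zero by simp
    then show False using unit s mT by blast
  qed
  have "trans ?r"
  proof (rule transI)
    fix x y z assume "(x, y) \<in> ?r" "(y, z) \<in> ?r"
    then obtain s t where "s \<in> T" "s \<noteq> 0" "y = s + x" "t \<in> T" "z = t + y" "x \<in> T" "z \<in> T"
      by (auto simp: proper_divisor_def)
    moreover from this have "t + s \<noteq> 0" using unit[of s t] by (auto simp: add_ac)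
    ultimately show "(x, z) \<in> ?r"
      unfolding proper_divisor_def by (auto simp: add_ac intro!: bexI[of _ "t + s"] add)
  qed
  moreover have "disj_wf ?r"
  proof -
    obtain e where e: "bij_betw e {..<card G} G"
      using ex_bij_betw_nat_finite[OF G(1)] by (auto simp: atLeast0LessThan)
    have "?r \<subseteq> (\<Union>i<card G. Wellfounded.measure (\<lambda>x. n x (e i)))"
    proof
      fix z assume z: "z \<in> ?r"
      obtain y x where yx: "z = (y, x)" by (cases z)
      obtain g where "g \<in> G" "n y g < n x g" using drop z yx by blast
      moreover from this obtain i where "i < card G" "g = e i"
        using bij_betw_imp_surj_on[OF e] by blast
      ultimately show "z \<in> (\<Union>i<card G. Wellfounded.measure (\<lambda>x. n x (e i)))"
        using yx by auto
    qed
    then show ?thesis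
      unfolding disj_wf by (intro exI[of _ "\<lambda>i. Wellfounded.measure (\<lambda>x. n x (e i))"]) auto
  qed
  ultimately show ?thesis by (rule trans_disj_wf_implies_wf)
qed

text \<open>The elements of \<open>T\<close> that are minimal for translation by \<open>S\<close>. For the monoid \<open>T\<close> they are the
  exponents of the Apery monomials; for an ideal \<open>T\<close> of the monoid \<open>S\<close> they are the minimal
  generators of \<open>T\<close>.\<close>

definition apery_set :: "'s::comm_monoid_add set \<Rightarrow> 's set \<Rightarrow> 's set" where
  "apery_set S T = {w \<in> T. \<not> (\<exists>s\<in>S. s \<noteq> 0 \<and> (\<exists>v\<in>T. w = s + v))}"

lemma apery_decomposition_exists:
  assumes T: "affine_semigroup T" "positive_monoid T" and S: "add_submonoid S" "S \<subseteq> T"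
    and x: "x \<in> T"
  shows "\<exists>s\<in>S. \<exists>w\<in>apery_set S T. x = s + w"
  using wf_proper_divisor[OF T] x
proof (induction x rule: wf_induct_rule)
  case (less x)
  show ?case
  proof (cases "x \<in> apery_set S T")
    case True
    moreover have "0 \<in> S" "x = 0 + x" using S by (auto simp: add_submonoid_def)
    ultimately show ?thesis by blast
  next
    case False
    then obtain s v where s: "s \<in> S" "s \<noteq> 0" "v \<in> T" "x = s + v"
      using less.prems by (auto simp: apery_set_def)
    then have "(v, x) \<in> proper_divisor T"
      using S(2) less.prems by (auto simp: proper_divisor_def)
    from less.IH[OF this s(3)] obtain t w where "t \<in> S" "w \<in> apery_set S T" "v = t + w" by blast
    then show ?thesis using s S(1)
      by (intro bexI[of _ "s + t"] bexI[of _ w]) (auto simp: add_submonoid_def add_ac)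
  qed
qed

definition unique_apery_decompositions :: "'s::comm_monoid_add set \<Rightarrow> 's set \<Rightarrow> bool" where
  "unique_apery_decompositions S T \<longleftrightarrow>
     (\<forall>s\<in>S. \<forall>t\<in>S. \<forall>v\<in>apery_set S T. \<forall>w\<in>apery_set S T. s + v = t + w \<longrightarrow> s = t \<and> v = w)"

lemma single_one_eq_iff [simp]:
  "Poly_Mapping.single s (1::'k::zero_neq_one) = Poly_Mapping.single t 1 \<longleftrightarrow> s = t"
  by (metis lookup_single_eq lookup_single_not_eq zero_neq_one)

lemma single_one_eq_one_iff [simp]:
  "Poly_Mapping.single (s::'s::comm_monoid_add) (1::'k::field) = 1 \<longleftrightarrow> s = 0"
  by (metis single_one single_one_eq_iff)

lemma is_representation_single_iff:
  fixes S T :: "'s::comm_monoid_add set"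
  shows "is_representation S T (Poly_Mapping.single x (1::'k::field)) r \<longleftrightarrow>
    (\<exists>s\<in>S. \<exists>w\<in>apery_set S T. r = (Poly_Mapping.single s 1, Poly_Mapping.single w 1) \<and> x = s + w)"
proof -
  let ?u = "\<lambda>s. Poly_Mapping.single s (1::'k)"
  have mult: "?u s * ?u t = ?u (s + t)" for s t :: 's by (simp add: mult_single)
  have apery: "apery_monomial S T (?u w) \<longleftrightarrow> w \<in> apery_set S T" for w
    unfolding apery_monomial_def apery_set_def monomials_def bex_simps mult mem_Collect_eq
      single_one_eq_iff single_one_eq_one_iff by (simp add: image_iff)
  have "apery_monomial S T m \<Longrightarrow> \<exists>w. m = ?u w" for m
    by (auto simp: apery_monomial_def monomials_def)
  with apery have "apery_monomial S T m \<longleftrightarrow> (\<exists>w\<in>apery_set S T. m = ?u w)" for m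
    by blast
  then have rep: "is_representation S T (?u x) (a, m) \<longleftrightarrow>
      (\<exists>s\<in>S. a = ?u s) \<and> (\<exists>w\<in>apery_set S T. m = ?u w) \<and> ?u x = a * m" for a m
    by (auto simp: is_representation_def monomials_def)
  show ?thesis
  proof
    assume "is_representation S T (?u x) r"
    then obtain s w where sw: "s \<in> S" "w \<in> apery_set S T" "r = (?u s, ?u w)" "?u x = ?u s * ?u w"
      using rep by (cases r) fast
    moreover have "x = s + w" using sw(4) unfolding mult single_one_eq_iff .
    ultimately show "\<exists>s\<in>S. \<exists>w\<in>apery_set S T. r = (?u s, ?u w) \<and> x = s + w" by blast
  next
    assume "\<exists>s\<in>S. \<exists>w\<in>apery_set S T. r = (?u s, ?u w) \<and> x = s + w"
    then obtain s w where sw: "s \<in> S" "w \<in> apery_set S T" "r = (?u s, ?u w)" "x = s + w" by blast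
    show "is_representation S T (?u x) r"
      unfolding sw(3) rep using sw by (auto simp: mult)
  qed
qed

text \<open>Existence of representations being automatic, only uniqueness has to be asked for. This
  is a condition on exponents, independent of the field.\<close>

lemma unique_representation_iff:
  fixes S T :: "'s::comm_monoid_add set"
  assumes T: "affine_semigroup T" "positive_monoid T" and S: "add_submonoid S" "S \<subseteq> T"
  shows "(\<forall>x \<in> (monomials T :: ('s \<Rightarrow>\<^sub>0 'k::field) set). \<exists>!r. is_representation S T x r) \<longleftrightarrow>
    unique_apery_decompositions S T"
    (is "?L \<longleftrightarrow> ?R")
proof
  assume L: ?L
  have TT: "s + v \<in> T" if "s \<in> S" "v \<in> apery_set S T" for s v
  proof -
    have "add_submonoid T" using T(1) by (simp add: affine_semigroup_def)
    moreover have "s \<in> T" "v \<in> T" using that S(2) by (auto simp: apery_set_def)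
    ultimately show ?thesis by (simp add: add_submonoid_def)
  qed
  show ?R
    unfolding unique_apery_decompositions_def
  proof (intro ballI impI)
    fix s t v w
    assume *: "s \<in> S" "t \<in> S" "v \<in> apery_set S T" "w \<in> apery_set S T" "s + v = t + w"
    let ?u = "\<lambda>s. Poly_Mapping.single s (1::'k)"
    have "\<exists>!r. is_representation S T (?u (s + v)) r"
      using L TT[OF *(1,3)] by (simp add: monomials_def)
    moreover have "is_representation S T (?u (s + v)) (?u s, ?u v)"
      "is_representation S T (?u (s + v)) (?u t, ?u w)"
      unfolding is_representation_single_iff using * by blast+
    ultimately have "(?u s, ?u v) = (?u t, ?u w)" by blast
    then show "s = t \<and> v = w" by simp
  qed
next
  assume R: ?R
  show ?L
  proof
    fix m :: "'s \<Rightarrow>\<^sub>0 'k" assume "m \<in> monomials T"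
    then obtain x where x: "x \<in> T" "m = Poly_Mapping.single x 1" by (auto simp: monomials_def)
    obtain s w where sw: "s \<in> S" "w \<in> apery_set S T" "x = s + w"
      using apery_decomposition_exists[OF T S x(1)] by blast
    show "\<exists>!r. is_representation S T m r"
      unfolding x(2) is_representation_single_iff
    proof (rule ex1I[of _ "(Poly_Mapping.single s 1, Poly_Mapping.single w 1)"])
      fix r assume "\<exists>t\<in>S. \<exists>v\<in>apery_set S T.
        r = (Poly_Mapping.single t (1::'k), Poly_Mapping.single v (1::'k)) \<and> x = t + v"
      then obtain t v where "t \<in> S" "v \<in> apery_set S T" "x = t + v"
        and r: "r = (Poly_Mapping.single t 1, Poly_Mapping.single v 1)" by blast
      with R sw have "t = s \<and> v = w"
        unfolding unique_apery_decompositions_def by metis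
      then show "r = (Poly_Mapping.single s 1, Poly_Mapping.single w 1)" using r by simp
    qed (use sw in blast)
  qed
qed

section \<open>Monoid rings and the Apery basis\<close>

lemma sum_monomials: "(\<Sum>s\<in>Poly_Mapping.keys f. Poly_Mapping.single s (Poly_Mapping.lookup f s)) = f"
  by (rule poly_mapping_eqI)
    (simp add: lookup_sum lookup_single when_def sum.delta' in_keys_iff cong: if_cong)

text \<open>A coefficient of a product is a single product of coefficients as soon as only one pair of
  exponents can contribute to it.\<close>

lemma lookup_mult_sole_pair:
  fixes f g :: "'s::comm_monoid_add \<Rightarrow>\<^sub>0 'k::field"
  assumes "\<And>s t. s \<in> Poly_Mapping.keys f \<Longrightarrow> t \<in> Poly_Mapping.keys g \<Longrightarrow> s + t = s0 + t0 \<Longrightarrow> s = s0 \<and> t = t0"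
  shows "Poly_Mapping.lookup (f * g) (s0 + t0) = Poly_Mapping.lookup f s0 * Poly_Mapping.lookup g t0"
proof -
  let ?l = Poly_Mapping.lookup
  have "f * g = (\<Sum>s\<in>Poly_Mapping.keys f. Poly_Mapping.single s (?l f s)) *
      (\<Sum>t\<in>Poly_Mapping.keys g. Poly_Mapping.single t (?l g t))"
    by (simp only: sum_monomials)
  also have "\<dots> = (\<Sum>s\<in>Poly_Mapping.keys f. \<Sum>t\<in>Poly_Mapping.keys g.
      Poly_Mapping.single (s + t) (?l f s * ?l g t))"
    by (simp add: sum_product mult_single)
  finally have "?l (f * g) (s0 + t0) = (\<Sum>s\<in>Poly_Mapping.keys f. \<Sum>t\<in>Poly_Mapping.keys g.
      if s + t = s0 + t0 then ?l f s * ?l g t else 0)"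
    by (simp add: lookup_sum lookup_single when_def)
  also have "\<dots> = (\<Sum>s\<in>Poly_Mapping.keys f. \<Sum>t\<in>Poly_Mapping.keys g.
      if t = t0 then if s = s0 then ?l f s * ?l g t else 0 else 0)"
    using assms by (intro sum.cong refl) auto
  also have "\<dots> = ?l f s0 * ?l g t0"
    by (cases "t0 \<in> Poly_Mapping.keys g") (auto simp: sum.delta in_keys_iff)
  finally show ?thesis .
qed

lemma monoid_ring_simps [simp]:
  "carrier (monoid_ring S) = {f. Poly_Mapping.keys f \<subseteq> S}"
  "\<zero>\<^bsub>monoid_ring S\<^esub> = 0" "f \<oplus>\<^bsub>monoid_ring S\<^esub> g = f + g" "f \<otimes>\<^bsub>monoid_ring S\<^esub> g = f * g"
  "\<one>\<^bsub>monoid_ring S\<^esub> = 1"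
  by (simp_all add: monoid_ring_def)

lemma ring_as_module_simps [simp]:
  "carrier (ring_as_module A) = carrier A"
  "\<zero>\<^bsub>ring_as_module A\<^esub> = \<zero>\<^bsub>A\<^esub>" "f \<oplus>\<^bsub>ring_as_module A\<^esub> g = f \<oplus>\<^bsub>A\<^esub> g"
  "f \<odot>\<^bsub>ring_as_module A\<^esub> g = f \<otimes>\<^bsub>A\<^esub> g"
  by (simp_all add: ring_as_module_def)

lemma finsum_monoid_ring:
  fixes g :: "'a \<Rightarrow> 's::comm_monoid_add \<Rightarrow>\<^sub>0 'k::field"
  assumes T: "add_submonoid T" and "finite F" "\<And>x. x \<in> F \<Longrightarrow> Poly_Mapping.keys (g x) \<subseteq> T"
  shows "finsum (ring_as_module (monoid_ring T)) g F = sum g F"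
proof -
  interpret module "monoid_ring T :: ('s \<Rightarrow>\<^sub>0 'k) ring" "ring_as_module (monoid_ring T)"
    using module_monoid_ring[OF T T] by simp
  show ?thesis
    using assms(2,3)
  proof (induction F)
    case empty
    show ?case by simp
  next
    case (insert x F)
    then have "g \<in> F \<rightarrow> carrier (ring_as_module (monoid_ring T))"
      "g x \<in> carrier (ring_as_module (monoid_ring T))"
      by auto
    with insert show ?case by (simp add: finsum_insert)
  qed
qed

lemma keys_times_subset:
  fixes f g :: "'s::comm_monoid_add \<Rightarrow>\<^sub>0 'k::field"
  assumes "Poly_Mapping.keys f \<subseteq> S" "Poly_Mapping.keys g \<subseteq> J" "\<And>s j. s \<in> S \<Longrightarrow> j \<in> J \<Longrightarrow> s + j \<in> J"
  shows "Poly_Mapping.keys (f * g) \<subseteq> J"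
  using keys_mult[of f g] assms by blast

text \<open>Grouping the terms of a polynomial by the Apery part of their exponents writes it in terms of
  Apery monomials. In a combination \<open>\<Sum> c b * b\<close>, uniqueness of decompositions makes the
  coefficient at \<open>s + w\<close> equal to the coefficient at \<open>s\<close> of the scalar belonging to \<open>w\<close>, so a
  vanishing combination has vanishing scalars.\<close>

lemma apery_monomials_basis:
  fixes S T :: "'s::comm_monoid_add set"
  assumes T: "affine_semigroup T" "positive_monoid T" and S: "add_submonoid S" "S \<subseteq> T"
    and uniq: "unique_apery_decompositions S T"
  shows "module_basis (monoid_ring S :: ('s \<Rightarrow>\<^sub>0 'k::field) ring) (ring_as_module (monoid_ring T))
    (monomials (apery_set S T))"
proof -
  let ?u = "\<lambda>w. Poly_Mapping.single w (1::'k)"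
  let ?l = Poly_Mapping.lookup
  have subT: "add_submonoid T" using T by (simp add: affine_semigroup_def)
  have addT: "\<And>s t. s \<in> S \<Longrightarrow> t \<in> T \<Longrightarrow> s + t \<in> T"
    using subT S(2) by (simp add: add_submonoid_def subset_iff)
  have aT: "apery_set S T \<subseteq> T" by (auto simp: apery_set_def)
  have summand: "Poly_Mapping.keys (c b * b) \<subseteq> T"
    if b: "b \<in> F" and sub: "F \<subseteq> monomials (apery_set S T)" and c: "c \<in> F \<rightarrow> carrier (monoid_ring S)"
    for F c and b :: "'s \<Rightarrow>\<^sub>0 'k"
  proof -
    obtain w where "w \<in> apery_set S T" "b = ?u w" using b sub by (auto simp: monomials_def)
    then have "Poly_Mapping.keys b \<subseteq> T" using aT by auto
    moreover have "Poly_Mapping.keys (c b) \<subseteq> S" using b c by auto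
    ultimately show ?thesis by (intro keys_times_subset[OF _ _ addT])
  qed
  show ?thesis
    unfolding module_basis_def
  proof (intro conjI ballI allI impI)
    show "monomials (apery_set S T) \<subseteq> carrier (ring_as_module (monoid_ring T :: ('s \<Rightarrow>\<^sub>0 'k) ring))"
      using aT by (auto simp: monomials_def)
  next
    fix x :: "'s \<Rightarrow>\<^sub>0 'k" assume "x \<in> carrier (ring_as_module (monoid_ring T))"
    then have x: "Poly_Mapping.keys x \<subseteq> T" by simp
    have "\<forall>y\<in>T. \<exists>s w. s \<in> S \<and> w \<in> apery_set S T \<and> y = s + w"
      using apery_decomposition_exists[OF T S] by blast
    then obtain s w where sw: "\<And>y. y \<in> T \<Longrightarrow> s y \<in> S \<and> w y \<in> apery_set S T \<and> y = s y + w y"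
      by metis
    define F where "F = (\<lambda>y. ?u (w y)) ` Poly_Mapping.keys x"
    define c where "c b = (\<Sum>y\<in>{y \<in> Poly_Mapping.keys x. ?u (w y) = b}. Poly_Mapping.single (s y) (?l x y))"
      for b
    have F: "finite F" "F \<subseteq> monomials (apery_set S T)"
      using x sw by (auto simp: F_def monomials_def)
    have c: "c \<in> F \<rightarrow> carrier (monoid_ring S)"
    proof
      fix b
      have "Poly_Mapping.keys (c b) \<subseteq>
          (\<Union>y\<in>{y \<in> Poly_Mapping.keys x. ?u (w y) = b}. Poly_Mapping.keys (Poly_Mapping.single (s y) (?l x y)))"
        unfolding c_def by (rule keys_sum)
      also have "\<dots> \<subseteq> S" using x sw by (auto split: if_splits)
      finally show "c b \<in> carrier (monoid_ring S)" by simp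
    qed
    have "x = (\<Sum>y\<in>Poly_Mapping.keys x. Poly_Mapping.single (s y) (?l x y) * ?u (w y))"
      using x sw by (subst sum_monomials[symmetric], intro sum.cong) (auto simp: mult_single)
    also have "\<dots> = (\<Sum>b\<in>F. \<Sum>y\<in>{y \<in> Poly_Mapping.keys x. ?u (w y) = b}.
        Poly_Mapping.single (s y) (?l x y) * ?u (w y))"
      unfolding F_def by (rule sum.image_gen) simp
    also have "\<dots> = (\<Sum>b\<in>F. c b * b)"
      unfolding c_def sum_distrib_right by (intro sum.cong) auto
    also have "\<dots> = (\<Oplus>\<^bsub>ring_as_module (monoid_ring T)\<^esub>b\<in>F. c b \<odot>\<^bsub>ring_as_module (monoid_ring T)\<^esub> b)"
      using F c summand by (simp add: finsum_monoid_ring[OF subT])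
    finally show "\<exists>F c. finite F \<and> F \<subseteq> monomials (apery_set S T) \<and> c \<in> F \<rightarrow> carrier (monoid_ring S) \<and>
        x = (\<Oplus>\<^bsub>ring_as_module (monoid_ring T)\<^esub>b\<in>F. c b \<odot>\<^bsub>ring_as_module (monoid_ring T)\<^esub> b)"
      using F c by blast
  next
    fix F c and b :: "'s \<Rightarrow>\<^sub>0 'k"
    assume H: "finite F \<and> F \<subseteq> monomials (apery_set S T) \<and> c \<in> F \<rightarrow> carrier (monoid_ring S) \<and>
        (\<Oplus>\<^bsub>ring_as_module (monoid_ring T)\<^esub>b\<in>F. c b \<odot>\<^bsub>ring_as_module (monoid_ring T)\<^esub> b) =
          \<zero>\<^bsub>ring_as_module (monoid_ring T)\<^esub>" and b: "b \<in> F"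
    then have sum0: "(\<Sum>b\<in>F. c b * b) = 0"
      using finsum_monoid_ring[OF subT, of F "\<lambda>b. c b * b"] summand[of _ F c] by simp
    have cS: "\<And>b. b \<in> F \<Longrightarrow> Poly_Mapping.keys (c b) \<subseteq> S" using H by auto
    obtain w where w: "w \<in> apery_set S T" "b = ?u w" using H b by (auto simp: monomials_def)
    have "?l (c b) s = 0" if s: "s \<in> S" for s
    proof -
      have "?l (c b' * b') (s + w) = (if b' = b then ?l (c b) s else 0)" if b': "b' \<in> F" for b'
      proof -
        obtain v where v: "v \<in> apery_set S T" "b' = ?u v" using H b' by (auto simp: monomials_def)
        have "?l (c b' * b') (s + w) = ?l (c b') s * ?l b' w"
        proof (rule lookup_mult_sole_pair)
          fix t v' assume "t \<in> Poly_Mapping.keys (c b')" "v' \<in> Poly_Mapping.keys b'" "t + v' = s + w"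
          then show "t = s \<and> v' = w"
            using uniq cS[OF b'] s v w unfolding unique_apery_decompositions_def by auto
        qed
        then show ?thesis using v w by (auto simp: lookup_single when_def)
      qed
      then have "(\<Sum>b'\<in>F. ?l (c b' * b') (s + w)) = ?l (c b) s"
        using b H by (simp add: sum.delta)
      moreover have "(\<Sum>b'\<in>F. ?l (c b' * b') (s + w)) = 0"
        using sum0 by (simp flip: lookup_sum)
      ultimately show ?thesis by simp
    qed
    moreover have "?l (c b) s = 0" if "s \<notin> S" for s
      using that cS[OF b] by (auto simp: in_keys_iff)
    ultimately have "?l (c b) s = 0" for s by blast
    then show "c b = \<zero>\<^bsub>monoid_ring S\<^esub>"
      by (simp add: poly_mapping_eqI)
  qed
qed


section \<open>Monomial ideals as test modules\<close>

text \<open>The span of the monomials with exponents in \<open>J\<close>, as a module over \<open>\<kappa>[S]\<close> when \<open>J\<close> is stable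
  under \<open>S\<close>. It is placed in the left summand because flatness quantifies over modules on a sum type
  whose left summand is the type of the ring.\<close>

definition monomial_span_module :: "'s set \<Rightarrow> ('s::comm_monoid_add \<Rightarrow>\<^sub>0 'k::field, ('s \<Rightarrow>\<^sub>0 'k) + 'u) module" where
  "monomial_span_module J =
     \<lparr>carrier = Inl ` {f. Poly_Mapping.keys f \<subseteq> J}, monoid.mult = (\<lambda>x y. x), one = Inl 0,
      ring.zero = Inl 0, ring.add = (\<lambda>x y. Inl (projl x + projl y)), smult = (\<lambda>a x. Inl (a * projl x))\<rparr>"

lemma monomial_span_module_simps [simp]:
  "x \<in> carrier (monomial_span_module J) \<longleftrightarrow> (\<exists>f. Poly_Mapping.keys f \<subseteq> J \<and> x = Inl f)"
  "\<zero>\<^bsub>monomial_span_module J\<^esub> = Inl 0"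
  "x \<oplus>\<^bsub>monomial_span_module J\<^esub> y = Inl (projl x + projl y)"
  "a \<odot>\<^bsub>monomial_span_module J\<^esub> x = Inl (a * projl x)"
  by (auto simp: monomial_span_module_def)

lemma module_monomial_span:
  fixes S J :: "'s::comm_monoid_add set"
  assumes S: "add_submonoid S" and J: "\<And>s j. s \<in> S \<Longrightarrow> j \<in> J \<Longrightarrow> s + j \<in> J"
  shows "module (monoid_ring S :: ('s \<Rightarrow>\<^sub>0 'k::field) ring)
    (monomial_span_module J :: ('s \<Rightarrow>\<^sub>0 'k, ('s \<Rightarrow>\<^sub>0 'k) + 'u) module)"
proof (rule moduleI)
  show "cring (monoid_ring S :: ('s \<Rightarrow>\<^sub>0 'k) ring)"
    using module_monoid_ring[OF S S] by (auto simp: module_def)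
  have add: "Poly_Mapping.keys (f + g) \<subseteq> J"
    if "Poly_Mapping.keys f \<subseteq> J" "Poly_Mapping.keys g \<subseteq> J" for f g :: "'s \<Rightarrow>\<^sub>0 'k"
    using that Poly_Mapping.keys_add[of f g] by blast
  show "abelian_group (monomial_span_module J :: ('s \<Rightarrow>\<^sub>0 'k, ('s \<Rightarrow>\<^sub>0 'k) + 'u) module)"
  proof (rule abelian_groupI)
    fix x :: "('s \<Rightarrow>\<^sub>0 'k) + 'u" assume "x \<in> carrier (monomial_span_module J)"
    then obtain f where "Poly_Mapping.keys f \<subseteq> J" "x = Inl f" by auto
    then show "\<exists>y\<in>carrier (monomial_span_module J). y \<oplus>\<^bsub>monomial_span_module J\<^esub> x =
        \<zero>\<^bsub>monomial_span_module J :: ('s \<Rightarrow>\<^sub>0 'k, ('s \<Rightarrow>\<^sub>0 'k) + 'u) module\<^esub>"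
      by (intro bexI[of _ "Inl (- f)"]) auto
  qed (auto simp: add_ac dest!: subsetD[OF Poly_Mapping.keys_add])
next
  fix a :: "'s \<Rightarrow>\<^sub>0 'k" and x :: "('s \<Rightarrow>\<^sub>0 'k) + 'u"
  assume "a \<in> carrier (monoid_ring S)" "x \<in> carrier (monomial_span_module J)"
  then obtain f where "Poly_Mapping.keys a \<subseteq> S" "Poly_Mapping.keys f \<subseteq> J" "x = Inl f" by auto
  then show "a \<odot>\<^bsub>monomial_span_module J\<^esub> x \<in> carrier (monomial_span_module J)"
    using keys_times_subset[of a S f J] J by simp
qed (auto simp: distrib_left distrib_right mult.assoc)


section \<open>Calculating in tensor products\<close>

lemma tensor_kernel_subgroup:
  assumes P: "module R P" and M: "module R M"
  shows "subgroup (tensor_kernel R P M) (free_Abelian_group (carrier P \<times> carrier M))"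
proof -
  interpret P: module R P by fact
  interpret M: module R M by fact
  have "tensor_relators R P M \<subseteq> carrier (free_Abelian_group (carrier P \<times> carrier M))"
    unfolding tensor_relators_def free_Abelian_group_def
    by (auto dest!: subsetD[OF keys_diff])
  then show ?thesis
    unfolding tensor_kernel_def by (intro group.generate_is_subgroup) simp_all
qed

lemma tensor_kernel_closed:
  assumes P: "module R P" and M: "module R M"
  shows tensor_kernel_zero: "0 \<in> tensor_kernel R P M"
    and tensor_kernel_add: "\<And>t u. t \<in> tensor_kernel R P M \<Longrightarrow> u \<in> tensor_kernel R P M \<Longrightarrow> t + u \<in> tensor_kernel R P M"
    and tensor_kernel_uminus: "\<And>t. t \<in> tensor_kernel R P M \<Longrightarrow> - t \<in> tensor_kernel R P M"
    and tensor_kernel_diff: "\<And>t u. t \<in> tensor_kernel R P M \<Longrightarrow> u \<in> tensor_kernel R P M \<Longrightarrow> t - u \<in> tensor_kernel R P M"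
    and tensor_kernel_sum: "\<And>A f. (\<And>i. i \<in> A \<Longrightarrow> f i \<in> tensor_kernel R P M) \<Longrightarrow> sum f A \<in> tensor_kernel R P M"
proof -
  let ?K = "tensor_kernel R P M"
  interpret K: subgroup ?K "free_Abelian_group (carrier P \<times> carrier M)"
    by (rule tensor_kernel_subgroup[OF P M])
  have keys: "Poly_Mapping.keys t \<subseteq> carrier P \<times> carrier M" if "t \<in> ?K" for t
    using subsetD[OF K.subset that] by simp
  show zero: "0 \<in> ?K" using K.one_closed by simp
  show add: "t + u \<in> ?K" if "t \<in> ?K" "u \<in> ?K" for t u
    using K.m_closed[OF that] by simp
  show uminus: "- t \<in> ?K" if "t \<in> ?K" for t
    using K.m_inv_closed[OF that] keys[OF that] by simp
  show "t - u \<in> ?K" if "t \<in> ?K" "u \<in> ?K" for t u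
    using add[OF that(1) uminus[OF that(2)]] by simp
  show "sum f A \<in> ?K" if "\<And>i. i \<in> A \<Longrightarrow> f i \<in> ?K" for f and A :: "'z set"
    using that by (induction A rule: infinite_finite_induct) (auto intro: zero add)
qed

lemma
  assumes "x \<in> carrier M" "p \<in> carrier P"
  shows tensor_kernel_add_left: "q \<in> carrier P \<Longrightarrow>
      frag_of (p \<oplus>\<^bsub>P\<^esub> q, x) - frag_of (p, x) - frag_of (q, x) \<in> tensor_kernel R P M"
    and tensor_kernel_add_right: "y \<in> carrier M \<Longrightarrow>
      frag_of (p, x \<oplus>\<^bsub>M\<^esub> y) - frag_of (p, x) - frag_of (p, y) \<in> tensor_kernel R P M"
    and tensor_kernel_smult: "a \<in> carrier R \<Longrightarrow>
      frag_of (a \<odot>\<^bsub>P\<^esub> p, x) - frag_of (p, a \<odot>\<^bsub>M\<^esub> x) \<in> tensor_kernel R P M"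
  unfolding tensor_kernel_def tensor_relators_def using assms
  by (intro generate.incl; blast)+

lemma tensor_kernel_zero_left:
  assumes P: "module R P" and M: "module R M" and x: "x \<in> carrier M"
  shows "frag_of (\<zero>\<^bsub>P\<^esub>, x) \<in> tensor_kernel R P M"
proof -
  interpret P: module R P by fact
  show ?thesis
    using tensor_kernel_uminus[OF P M tensor_kernel_add_left[OF x P.zero_closed P.zero_closed, of R]]
    by simp
qed

lemma tensor_kernel_zero_right:
  assumes P: "module R P" and M: "module R M" and p: "p \<in> carrier P"
  shows "frag_of (p, \<zero>\<^bsub>M\<^esub>) \<in> tensor_kernel R P M"
proof -
  interpret M: module R M by fact
  show ?thesis
    using tensor_kernel_uminus[OF P M tensor_kernel_add_right[OF M.zero_closed p M.zero_closed, of R]]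
    by simp
qed

lemma tensor_kernel_diff_right:
  assumes P: "module R P" and M: "module R M" and p: "p \<in> carrier P"
    and x: "x \<in> carrier M" and y: "y \<in> carrier M"
  shows "frag_of (p, x) - frag_of (p, y) - frag_of (p, x \<ominus>\<^bsub>M\<^esub> y) \<in> tensor_kernel R P M"
proof -
  interpret M: module R M by fact
  have eq: "(x \<ominus>\<^bsub>M\<^esub> y) \<oplus>\<^bsub>M\<^esub> y = x"
    using x y by (simp add: M.minus_eq M.add.m_assoc M.l_neg)
  have "x \<ominus>\<^bsub>M\<^esub> y \<in> carrier M" using x y by simp
  from tensor_kernel_add_right[OF this p y, of R] show ?thesis
    unfolding eq by (simp add: algebra_simps)
qed

text \<open>The universal property of the tensor product, in the form in which it detects nonzero tensors:
  a combination of pairs on which some balanced map does not vanish is not in the kernel.\<close>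

lemma balanced_map_hom:
  fixes A :: "('c, 'd) monoid_scheme" (structure)
  assumes A: "comm_group A" and P: "module R P" and M: "module R M"
    and closed: "\<And>p x. p \<in> carrier P \<Longrightarrow> x \<in> carrier M \<Longrightarrow> \<beta> p x \<in> carrier A"
    and left: "\<And>p q x. p \<in> carrier P \<Longrightarrow> q \<in> carrier P \<Longrightarrow> x \<in> carrier M \<Longrightarrow>
      \<beta> (p \<oplus>\<^bsub>P\<^esub> q) x = \<beta> p x \<otimes> \<beta> q x"
    and right: "\<And>p x y. p \<in> carrier P \<Longrightarrow> x \<in> carrier M \<Longrightarrow> y \<in> carrier M \<Longrightarrow>
      \<beta> p (x \<oplus>\<^bsub>M\<^esub> y) = \<beta> p x \<otimes> \<beta> p y"
    and balanced: "\<And>a p x. a \<in> carrier R \<Longrightarrow> p \<in> carrier P \<Longrightarrow> x \<in> carrier M \<Longrightarrow>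
      \<beta> (a \<odot>\<^bsub>P\<^esub> p) x = \<beta> p (a \<odot>\<^bsub>M\<^esub> x)"
  obtains h where "h \<in> hom (free_Abelian_group (carrier P \<times> carrier M)) A"
    and "\<And>p x. p \<in> carrier P \<Longrightarrow> x \<in> carrier M \<Longrightarrow> h (frag_of (p, x)) = \<beta> p x"
    and "\<And>t. t \<in> tensor_kernel R P M \<Longrightarrow> h t = \<one>"
proof -
  interpret A: comm_group A by fact
  interpret P: module R P by fact
  interpret M: module R M by fact
  let ?G = "free_Abelian_group (carrier P \<times> carrier M)"
  have "(\<lambda>(p, x). \<beta> p x) ` (carrier P \<times> carrier M) \<subseteq> carrier A"
    using closed by auto
  then obtain h where h: "h \<in> hom ?G A"
    and gen: "\<And>z. z \<in> carrier P \<times> carrier M \<Longrightarrow> h (frag_of z) = (\<lambda>(p, x). \<beta> p x) z"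
    using A.free_Abelian_group_universal by blast
  have gen': "h (frag_of (p, x)) = \<beta> p x" if "p \<in> carrier P" "x \<in> carrier M" for p x
    using gen[of "(p, x)"] that by simp
  interpret h: group_hom ?G A h
    using h by (intro group_hom.intro group_hom_axioms.intro) (simp_all add: A.is_group)
  have diff: "h (a - b) = h a \<otimes> inv (h b)"
    if "Poly_Mapping.keys a \<subseteq> carrier P \<times> carrier M" "Poly_Mapping.keys b \<subseteq> carrier P \<times> carrier M" for a b
    using h.hom_mult[of a "- b"] h.hom_inv[of b] that by simp
  have k: "Poly_Mapping.keys (a - b) \<subseteq> carrier P \<times> carrier M"
    if "Poly_Mapping.keys a \<subseteq> carrier P \<times> carrier M" "Poly_Mapping.keys b \<subseteq> carrier P \<times> carrier M"
    for a b :: "_ \<Rightarrow>\<^sub>0 int"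
    using keys_diff[of a b] that by blast
  have cancel: "a \<otimes> b \<otimes> inv a \<otimes> inv b = \<one>" if "a \<in> carrier A" "b \<in> carrier A" for a b
    using A.r_inv[of "a \<otimes> b"] that by (simp add: A.inv_mult A.m_assoc)
  have "tensor_relators R P M \<subseteq> kernel ?G A h"
  proof -
    have "h (frag_of (p \<oplus>\<^bsub>P\<^esub> q, x) - frag_of (p, x) - frag_of (q, x)) = \<one>"
      if "p \<in> carrier P" "q \<in> carrier P" "x \<in> carrier M" for p q x
      using that by (simp add: diff k gen' left closed cancel)
    moreover have "h (frag_of (p, x \<oplus>\<^bsub>M\<^esub> y) - frag_of (p, x) - frag_of (p, y)) = \<one>"
      if "p \<in> carrier P" "x \<in> carrier M" "y \<in> carrier M" for p x y
      using that by (simp add: diff k gen' right closed cancel)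
    moreover have "h (frag_of (a \<odot>\<^bsub>P\<^esub> p, x) - frag_of (p, a \<odot>\<^bsub>M\<^esub> x)) = \<one>"
      if "a \<in> carrier R" "p \<in> carrier P" "x \<in> carrier M" for a p x
      using that by (simp add: diff k gen' balanced closed)
    ultimately show ?thesis
      unfolding tensor_relators_def kernel_def
      by (auto dest!: subsetD[OF keys_diff])
  qed
  then have "tensor_kernel R P M \<subseteq> kernel ?G A h"
    unfolding tensor_kernel_def
    by (rule group.generate_subgroup_incl[OF group_free_Abelian_group _ h.subgroup_kernel])
  then show thesis
    using that[OF h gen'] by (auto simp: kernel_def)
qed

lemma tensor_coset_eq_iff:
  assumes P: "module R P" and M: "module R M"
    and t: "Poly_Mapping.keys t \<subseteq> carrier P \<times> carrier M" and u: "Poly_Mapping.keys u \<subseteq> carrier P \<times> carrier M"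
  shows "tensor_kernel R P M #>\<^bsub>free_Abelian_group (carrier P \<times> carrier M)\<^esub> t =
      tensor_kernel R P M #>\<^bsub>free_Abelian_group (carrier P \<times> carrier M)\<^esub> u \<longleftrightarrow>
    t - u \<in> tensor_kernel R P M"
proof -
  let ?G = "free_Abelian_group (carrier P \<times> carrier M)" and ?K = "tensor_kernel R P M"
  interpret G: group ?G by simp
  interpret K: subgroup ?K ?G by (rule tensor_kernel_subgroup[OF P M])
  have carr: "t \<in> carrier ?G" "u \<in> carrier ?G" "t - u \<in> carrier ?G"
    using t u keys_diff[of t u] by auto
  show ?thesis
  proof
    assume "?K #>\<^bsub>?G\<^esub> t = ?K #>\<^bsub>?G\<^esub> u"
    from G.coset_mult_inv2[OF this carr(1,2) K.subset] have "?K #>\<^bsub>?G\<^esub> (t - u) = ?K"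
      using u by simp
    then show "t - u \<in> ?K" by (rule G.coset_join1[OF _ carr(3) K.subgroup_axioms])
  next
    assume "t - u \<in> ?K"
    then have "t \<in> ?K #>\<^bsub>?G\<^esub> u" unfolding r_coset_def by (auto intro!: bexI[of _ "t - u"])
    from G.repr_independence[OF this carr(2) K.subgroup_axioms]
    show "?K #>\<^bsub>?G\<^esub> t = ?K #>\<^bsub>?G\<^esub> u" ..
  qed
qed

lemma tensor_lift_keys:
  assumes f: "f \<in> linear_maps R M N" and t: "Poly_Mapping.keys t \<subseteq> carrier P \<times> carrier M"
  shows "Poly_Mapping.keys (frag_extend (\<lambda>(p, x). frag_of (p, f x)) t) \<subseteq> carrier P \<times> carrier N"
proof -
  have "Poly_Mapping.keys (frag_extend (\<lambda>(p, x). frag_of (p, f x)) t) \<subseteq>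
      (\<Union>z\<in>Poly_Mapping.keys t. Poly_Mapping.keys (case z of (p, x) \<Rightarrow> frag_of (p, f x)))"
    by (rule keys_frag_extend)
  also have "\<dots> \<subseteq> carrier P \<times> carrier N"
    using t f by (fastforce simp: linear_maps_def)
  finally show ?thesis .
qed

text \<open>Injectivity on cosets amounts to a trivial kernel; here it is restated for representatives in
  the free abelian groups, where all further computations take place.\<close>

lemma tensor_map_inj_iff:
  assumes M: "module R M" and N: "module R N" and f: "f \<in> linear_maps R M N" and P: "module R P"
  shows "inj_on (tensor_map R P M N f) (carrier (tensor_product R P M)) \<longleftrightarrow>
    (\<forall>t. Poly_Mapping.keys t \<subseteq> carrier P \<times> carrier M \<longrightarrow>
      frag_extend (\<lambda>(p, x). frag_of (p, f x)) t \<in> tensor_kernel R P N \<longrightarrow> t \<in> tensor_kernel R P M)"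
    (is "?inj \<longleftrightarrow> ?reflects")
proof -
  let ?\<phi> = "frag_extend (\<lambda>(p, x). frag_of (p, f x))"
  let ?G = "free_Abelian_group (carrier P \<times> carrier M)"
  let ?K = "tensor_kernel R P M" and ?L = "tensor_kernel R P N"
  have carrier: "carrier (tensor_product R P M) = (\<lambda>t. ?K #>\<^bsub>?G\<^esub> t) ` carrier ?G"
    by (auto simp: tensor_product_def FactGroup_def RCOSETS_def)
  have image: "tensor_map R P M N f (?K #>\<^bsub>?G\<^esub> t) = tensor_map R P M N f (?K #>\<^bsub>?G\<^esub> u) \<longleftrightarrow>
      ?\<phi> (t - u) \<in> ?L"
    if "t \<in> carrier ?G" "u \<in> carrier ?G" for t u
    using that
    by (simp add: tensor_map_coset[OF M N f P] frag_extend_diff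
        tensor_coset_eq_iff[OF P N] tensor_lift_keys[OF f])
  have "?inj \<longleftrightarrow> (\<forall>t\<in>carrier ?G. \<forall>u\<in>carrier ?G. ?\<phi> (t - u) \<in> ?L \<longrightarrow> t - u \<in> ?K)"
    unfolding inj_on_def carrier by (simp add: image tensor_coset_eq_iff[OF P M])
  also have "\<dots> \<longleftrightarrow> ?reflects"
  proof
    assume *: "\<forall>t\<in>carrier ?G. \<forall>u\<in>carrier ?G. ?\<phi> (t - u) \<in> ?L \<longrightarrow> t - u \<in> ?K"
    show ?reflects
    proof (intro allI impI)
      fix t assume "Poly_Mapping.keys t \<subseteq> carrier P \<times> carrier M" "?\<phi> t \<in> ?L"
      with *[rule_format, of t 0] show "t \<in> ?K" by simp
    qed
  next
    assume *: ?reflects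
    show "\<forall>t\<in>carrier ?G. \<forall>u\<in>carrier ?G. ?\<phi> (t - u) \<in> ?L \<longrightarrow> t - u \<in> ?K"
    proof (intro ballI impI)
      fix t u assume "t \<in> carrier ?G" "u \<in> carrier ?G" "?\<phi> (t - u) \<in> ?L"
      moreover from this have "Poly_Mapping.keys (t - u) \<subseteq> carrier P \<times> carrier M"
        using keys_diff[of t u] by auto
      ultimately show "t - u \<in> ?K" using * by blast
    qed
  qed
  finally show ?thesis .
qed

section \<open>Free modules\<close>

text \<open>The function \<open>c\<close> is total and zero off the finite set, so that an element of a free module has
  just one coordinate function and coordinates of sums need no common support.\<close>

definition coordinates ::
    "('r, 'x) ring_scheme \<Rightarrow> ('r, 'p, 'y) module_scheme \<Rightarrow> 'p set \<Rightarrow> 'p \<Rightarrow> ('p \<Rightarrow> 'r) \<Rightarrow> bool" where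
  "coordinates R P B x c \<longleftrightarrow>
     (\<exists>F. finite F \<and> F \<subseteq> B \<and> c \<in> UNIV \<rightarrow> carrier R \<and> (\<forall>b. b \<notin> F \<longrightarrow> c b = \<zero>\<^bsub>R\<^esub>) \<and>
        x = (\<Oplus>\<^bsub>P\<^esub>b\<in>F. c b \<odot>\<^bsub>P\<^esub> b))"

lemma coordinates_exist:
  assumes P: "module R P" and B: "module_basis R P B" and x: "x \<in> carrier P"
  shows "\<exists>c. coordinates R P B x c"
proof -
  interpret P: module R P by fact
  obtain F c where F: "finite F" "F \<subseteq> B" "c \<in> F \<rightarrow> carrier R" "x = (\<Oplus>\<^bsub>P\<^esub>b\<in>F. c b \<odot>\<^bsub>P\<^esub> b)"
    using B x unfolding module_basis_def by blast
  have BP: "B \<subseteq> carrier P" using B by (simp add: module_basis_def)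
  have "x = (\<Oplus>\<^bsub>P\<^esub>b\<in>F. (if b \<in> F then c b else \<zero>\<^bsub>R\<^esub>) \<odot>\<^bsub>P\<^esub> b)"
    unfolding F(4) using F BP
    by (intro P.finsum_cong') (auto intro!: P.smult_closed)
  then have "coordinates R P B x (\<lambda>b. if b \<in> F then c b else \<zero>\<^bsub>R\<^esub>)"
    unfolding coordinates_def using F by (intro exI[of _ F]) auto
  then show ?thesis by blast
qed

lemma coordinates_add:
  assumes P: "module R P" and B: "B \<subseteq> carrier P"
    and x: "coordinates R P B x c" and y: "coordinates R P B y d"
  shows "coordinates R P B (x \<oplus>\<^bsub>P\<^esub> y) (\<lambda>b. c b \<oplus>\<^bsub>R\<^esub> d b)"
proof -
  interpret P: module R P by fact
  obtain F where F: "finite F" "F \<subseteq> B" "c \<in> UNIV \<rightarrow> carrier R" "\<And>b. b \<notin> F \<Longrightarrow> c b = \<zero>\<^bsub>R\<^esub>"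
    "x = (\<Oplus>\<^bsub>P\<^esub>b\<in>F. c b \<odot>\<^bsub>P\<^esub> b)"
    using x unfolding coordinates_def by blast
  obtain G where G: "finite G" "G \<subseteq> B" "d \<in> UNIV \<rightarrow> carrier R" "\<And>b. b \<notin> G \<Longrightarrow> d b = \<zero>\<^bsub>R\<^esub>"
    "y = (\<Oplus>\<^bsub>P\<^esub>b\<in>G. d b \<odot>\<^bsub>P\<^esub> b)"
    using y unfolding coordinates_def by blast
  have in_P: "b \<in> carrier P" if "b \<in> F \<union> G" for b using that B F G by blast
  have cd: "c b \<in> carrier R" "d b \<in> carrier R" for b using F(3) G(3) by auto
  have "x = (\<Oplus>\<^bsub>P\<^esub>b\<in>F \<union> G. c b \<odot>\<^bsub>P\<^esub> b)"
    unfolding F(5) using F G in_P cd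
    by (intro P.add.finprod_mono_neutral_cong_left) auto
  moreover have "y = (\<Oplus>\<^bsub>P\<^esub>b\<in>F \<union> G. d b \<odot>\<^bsub>P\<^esub> b)"
    unfolding G(5) using F G in_P cd
    by (intro P.add.finprod_mono_neutral_cong_left) auto
  ultimately have "x \<oplus>\<^bsub>P\<^esub> y = (\<Oplus>\<^bsub>P\<^esub>b\<in>F \<union> G. c b \<odot>\<^bsub>P\<^esub> b \<oplus>\<^bsub>P\<^esub> d b \<odot>\<^bsub>P\<^esub> b)"
    using in_P cd by (simp add: P.finsum_addf Pi_def)
  also have "\<dots> = (\<Oplus>\<^bsub>P\<^esub>b\<in>F \<union> G. (c b \<oplus>\<^bsub>R\<^esub> d b) \<odot>\<^bsub>P\<^esub> b)"
    using in_P cd by (intro P.finsum_cong') (auto simp: P.smult_l_distr)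
  finally show ?thesis
    unfolding coordinates_def using F G cd by (intro exI[of _ "F \<union> G"]) auto
qed

lemma coordinates_smult:
  assumes P: "module R P" and B: "B \<subseteq> carrier P"
    and a: "a \<in> carrier R" and x: "coordinates R P B x c"
  shows "coordinates R P B (a \<odot>\<^bsub>P\<^esub> x) (\<lambda>b. a \<otimes>\<^bsub>R\<^esub> c b)"
proof -
  interpret P: module R P by fact
  obtain F where F: "finite F" "F \<subseteq> B" "c \<in> UNIV \<rightarrow> carrier R" "\<And>b. b \<notin> F \<Longrightarrow> c b = \<zero>\<^bsub>R\<^esub>"
    "x = (\<Oplus>\<^bsub>P\<^esub>b\<in>F. c b \<odot>\<^bsub>P\<^esub> b)"
    using x unfolding coordinates_def by blast
  have in_P: "b \<in> carrier P" if "b \<in> F" for b using that B F by blast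
  have c: "c b \<in> carrier R" for b using F(3) by auto
  have "a \<odot>\<^bsub>P\<^esub> x = (\<Oplus>\<^bsub>P\<^esub>b\<in>F. a \<odot>\<^bsub>P\<^esub> (c b \<odot>\<^bsub>P\<^esub> b))"
    unfolding F(5) using F(1) a in_P c by (intro P.finsum_smult_ldistr) auto
  also have "\<dots> = (\<Oplus>\<^bsub>P\<^esub>b\<in>F. (a \<otimes>\<^bsub>R\<^esub> c b) \<odot>\<^bsub>P\<^esub> b)"
    using in_P c a by (intro P.finsum_cong') (auto simp: P.smult_assoc1)
  finally show ?thesis
    unfolding coordinates_def using F a c by (intro exI[of _ F]) auto
qed

lemma coordinates_basis_element:
  assumes P: "module R P" and B: "B \<subseteq> carrier P" and b: "b \<in> B"
  shows "coordinates R P B b (\<lambda>b'. if b' = b then \<one>\<^bsub>R\<^esub> else \<zero>\<^bsub>R\<^esub>)"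
proof -
  interpret P: module R P by fact
  have "b \<in> carrier P" using B b by blast
  then show ?thesis
    unfolding coordinates_def using b by (intro exI[of _ "{b}"]) auto
qed

lemma coordinates_unique:
  assumes P: "module R P" and B: "module_basis R P B"
    and c: "coordinates R P B x c" and d: "coordinates R P B x d"
  shows "c = d"
proof
  fix b
  interpret P: module R P by fact
  have BP: "B \<subseteq> carrier P" using B by (simp add: module_basis_def)
  let ?m = "\<ominus>\<^bsub>R\<^esub> \<one>\<^bsub>R\<^esub>"
  have carr: "c b \<in> carrier R" "d b \<in> carrier R" using c d by (auto simp: coordinates_def)
  have x: "x \<in> carrier P"
    using c BP unfolding coordinates_def by (auto intro!: P.finsum_closed P.smult_closed)
  have "coordinates R P B (x \<oplus>\<^bsub>P\<^esub> ?m \<odot>\<^bsub>P\<^esub> x) (\<lambda>b. c b \<oplus>\<^bsub>R\<^esub> ?m \<otimes>\<^bsub>R\<^esub> d b)"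
    by (intro coordinates_add coordinates_smult P BP c d) simp
  moreover have "x \<oplus>\<^bsub>P\<^esub> ?m \<odot>\<^bsub>P\<^esub> x = \<zero>\<^bsub>P\<^esub>"
    using x by (simp add: P.smult_l_minus P.M.r_neg)
  ultimately have "coordinates R P B \<zero>\<^bsub>P\<^esub> (\<lambda>b. c b \<oplus>\<^bsub>R\<^esub> ?m \<otimes>\<^bsub>R\<^esub> d b)" by simp
  then obtain F where F: "finite F" "F \<subseteq> B" "(\<lambda>b. c b \<oplus>\<^bsub>R\<^esub> ?m \<otimes>\<^bsub>R\<^esub> d b) \<in> UNIV \<rightarrow> carrier R"
    "\<forall>b. b \<notin> F \<longrightarrow> c b \<oplus>\<^bsub>R\<^esub> ?m \<otimes>\<^bsub>R\<^esub> d b = \<zero>\<^bsub>R\<^esub>"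
    "\<zero>\<^bsub>P\<^esub> = (\<Oplus>\<^bsub>P\<^esub>b\<in>F. (c b \<oplus>\<^bsub>R\<^esub> ?m \<otimes>\<^bsub>R\<^esub> d b) \<odot>\<^bsub>P\<^esub> b)"
    unfolding coordinates_def by (elim exE conjE)
  have "c b \<oplus>\<^bsub>R\<^esub> ?m \<otimes>\<^bsub>R\<^esub> d b = \<zero>\<^bsub>R\<^esub>"
  proof (cases "b \<in> F")
    case True
    have "(\<lambda>b. c b \<oplus>\<^bsub>R\<^esub> ?m \<otimes>\<^bsub>R\<^esub> d b) \<in> F \<rightarrow> carrier R" using F(3) by auto
    then show ?thesis
      using B F(1,2) F(5)[symmetric] True unfolding module_basis_def by blast
  qed (use F(4) in blast)
  then have "c b \<oplus>\<^bsub>R\<^esub> \<ominus>\<^bsub>R\<^esub> d b = d b \<oplus>\<^bsub>R\<^esub> \<ominus>\<^bsub>R\<^esub> d b"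
    using carr by (simp add: P.R.l_minus P.R.r_neg)
  then show "c b = d b"
    using carr by simp
qed

lemma basis_coordinate_functions:
  assumes P: "module R P" and B: "module_basis R P B"
  obtains \<kappa> where "\<And>b x. x \<in> carrier P \<Longrightarrow> \<kappa> b x \<in> carrier R"
    and "\<And>b x y. x \<in> carrier P \<Longrightarrow> y \<in> carrier P \<Longrightarrow> \<kappa> b (x \<oplus>\<^bsub>P\<^esub> y) = \<kappa> b x \<oplus>\<^bsub>R\<^esub> \<kappa> b y"
    and "\<And>b a x. a \<in> carrier R \<Longrightarrow> x \<in> carrier P \<Longrightarrow> \<kappa> b (a \<odot>\<^bsub>P\<^esub> x) = a \<otimes>\<^bsub>R\<^esub> \<kappa> b x"
    and "\<And>b b'. b' \<in> B \<Longrightarrow> \<kappa> b b' = (if b = b' then \<one>\<^bsub>R\<^esub> else \<zero>\<^bsub>R\<^esub>)"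
proof -
  interpret P: module R P by fact
  have BP: "B \<subseteq> carrier P" using B by (simp add: module_basis_def)
  obtain k where k: "\<And>x. x \<in> carrier P \<Longrightarrow> coordinates R P B x (k x)"
    using coordinates_exist[OF P B] by metis
  have eq: "k x = c" if "x \<in> carrier P" "coordinates R P B x c" for x c
    using coordinates_unique[OF P B k[OF that(1)] that(2)] .
  show thesis
  proof (rule that[of "\<lambda>b x. k x b"])
    fix b x assume "x \<in> carrier P"
    then show "k x b \<in> carrier R" using k[of x] by (auto simp: coordinates_def)
  next
    fix b x y assume "x \<in> carrier P" "y \<in> carrier P"
    then show "k (x \<oplus>\<^bsub>P\<^esub> y) b = k x b \<oplus>\<^bsub>R\<^esub> k y b"
      using eq[OF _ coordinates_add[OF P BP k k]] by simp
  next
    fix b a x assume "a \<in> carrier R" "x \<in> carrier P"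
    then show "k (a \<odot>\<^bsub>P\<^esub> x) b = a \<otimes>\<^bsub>R\<^esub> k x b"
      using eq[OF _ coordinates_smult[OF P BP _ k]] by simp
  next
    fix b b' assume "b' \<in> B"
    then show "k b' b = (if b = b' then \<one>\<^bsub>R\<^esub> else \<zero>\<^bsub>R\<^esub>)"
      using eq[OF _ coordinates_basis_element[OF P BP]] BP by auto
  qed
qed


lemma tensor_kernel_expand_left:
  assumes P: "module R P" and M: "module R M" and x: "x \<in> carrier M"
    and "finite F" "F \<subseteq> carrier P" "c \<in> F \<rightarrow> carrier R"
  shows "frag_of (\<Oplus>\<^bsub>P\<^esub>b\<in>F. c b \<odot>\<^bsub>P\<^esub> b, x) - (\<Sum>b\<in>F. frag_of (b, c b \<odot>\<^bsub>M\<^esub> x)) \<in> tensor_kernel R P M"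
proof -
  interpret P: module R P by fact
  show ?thesis
    using assms(4-)
  proof (induction F)
    case empty
    then show ?case using tensor_kernel_zero_left[OF P M x] by simp
  next
    case (insert b F)
    let ?y = "\<Oplus>\<^bsub>P\<^esub>b\<in>F. c b \<odot>\<^bsub>P\<^esub> b"
    have carr: "b \<in> carrier P" "c b \<in> carrier R" and c: "(\<lambda>b. c b \<odot>\<^bsub>P\<^esub> b) \<in> F \<rightarrow> carrier P"
      using insert.prems by (auto intro!: P.smult_closed)
    then have y: "?y \<in> carrier P" by (intro P.finsum_closed)
    have cb: "c b \<odot>\<^bsub>P\<^esub> b \<in> carrier P" using carr by simp
    have sum: "(\<Oplus>\<^bsub>P\<^esub>b\<in>insert b F. c b \<odot>\<^bsub>P\<^esub> b) = c b \<odot>\<^bsub>P\<^esub> b \<oplus>\<^bsub>P\<^esub> ?y"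
      using insert.hyps c cb by (rule P.finsum_insert)
    let ?d1 = "frag_of (c b \<odot>\<^bsub>P\<^esub> b \<oplus>\<^bsub>P\<^esub> ?y, x) - frag_of (c b \<odot>\<^bsub>P\<^esub> b, x) - frag_of (?y, x)"
    let ?d2 = "frag_of (c b \<odot>\<^bsub>P\<^esub> b, x) - frag_of (b, c b \<odot>\<^bsub>M\<^esub> x)"
    let ?d3 = "frag_of (?y, x) - (\<Sum>b\<in>F. frag_of (b, c b \<odot>\<^bsub>M\<^esub> x))"
    have "?d1 + ?d2 + ?d3 \<in> tensor_kernel R P M"
      using insert by (intro tensor_kernel_add[OF P M] tensor_kernel_add_left tensor_kernel_smult x cb y carr) auto
    moreover have "?d1 + ?d2 + ?d3 = frag_of (c b \<odot>\<^bsub>P\<^esub> b \<oplus>\<^bsub>P\<^esub> ?y, x) -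
        (\<Sum>b\<in>insert b F. frag_of (b, c b \<odot>\<^bsub>M\<^esub> x))"
      using insert.hyps by simp
    ultimately show ?case unfolding sum by (simp only:)
  qed
qed

text \<open>Modulo the kernel, everything can be rewritten with one tensor \<open>b \<otimes> m b\<close> for each basis
  element. Differences of such sums are formed on the union of the two supports, after padding with
  tensors \<open>b \<otimes> 0\<close>; this is why \<open>m\<close> is required to vanish off \<open>F\<close>.\<close>

lemma tensor_normal_form:
  assumes P: "module R P" and M: "module R M" and B: "module_basis R P B"
    and t: "Poly_Mapping.keys t \<subseteq> carrier P \<times> carrier M"
  shows "\<exists>F m. finite F \<and> F \<subseteq> B \<and> m \<in> UNIV \<rightarrow> carrier M \<and> (\<forall>b. b \<notin> F \<longrightarrow> m b = \<zero>\<^bsub>M\<^esub>) \<and>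
    t - (\<Sum>b\<in>F. frag_of (b, m b)) \<in> tensor_kernel R P M"
  using t
proof (induction t rule: free_Abelian_group_induct[consumes 1, case_names zero diff generator])
  case zero
  interpret M: module R M by fact
  show ?case
    using tensor_kernel_zero[OF P M] by (intro exI[of _ "{}"] exI[of _ "\<lambda>_. \<zero>\<^bsub>M\<^esub>"]) auto
next
  case (diff t u)
  interpret M: module R M by fact
  have BP: "B \<subseteq> carrier P" using B by (simp add: module_basis_def)
  from diff obtain F m where F: "finite F" "F \<subseteq> B" "m \<in> UNIV \<rightarrow> carrier M" "\<And>b. b \<notin> F \<Longrightarrow> m b = \<zero>\<^bsub>M\<^esub>"
    and tF: "t - (\<Sum>b\<in>F. frag_of (b, m b)) \<in> tensor_kernel R P M" by blast
  from diff obtain G n where G: "finite G" "G \<subseteq> B" "n \<in> UNIV \<rightarrow> carrier M" "\<And>b. b \<notin> G \<Longrightarrow> n b = \<zero>\<^bsub>M\<^esub>"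
    and uG: "u - (\<Sum>b\<in>G. frag_of (b, n b)) \<in> tensor_kernel R P M" by blast
  have mn: "m b \<in> carrier M" "n b \<in> carrier M" for b using F(3) G(3) by auto
  have pad: "v - (\<Sum>b\<in>F \<union> G. frag_of (b, k b)) \<in> tensor_kernel R P M"
    if v: "v - (\<Sum>b\<in>H. frag_of (b, k b)) \<in> tensor_kernel R P M" and H: "H \<subseteq> F \<union> G"
      and k: "\<And>b. b \<notin> H \<Longrightarrow> k b = \<zero>\<^bsub>M\<^esub>" for v H k
  proof -
    have "(\<Sum>b\<in>F \<union> G. frag_of (b, k b)) = (\<Sum>b\<in>H. frag_of (b, k b)) + (\<Sum>b\<in>F \<union> G - H. frag_of (b, k b))"
      using sum.subset_diff[OF H] F(1) G(1) by (simp add: add.commute)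
    moreover have "(\<Sum>b\<in>F \<union> G - H. frag_of (b, k b)) \<in> tensor_kernel R P M"
    proof (rule tensor_kernel_sum[OF P M])
      fix b assume b: "b \<in> F \<union> G - H"
      then have "b \<in> carrier P" using F G BP by blast
      then show "frag_of (b, k b) \<in> tensor_kernel R P M"
        using k b tensor_kernel_zero_right[OF P M] by simp
    qed
    ultimately show ?thesis
      using tensor_kernel_diff[OF P M v] by (simp add: diff_diff_eq)
  qed
  have "(\<Sum>b\<in>F \<union> G. frag_of (b, m b) - frag_of (b, n b) - frag_of (b, m b \<ominus>\<^bsub>M\<^esub> n b)) \<in> tensor_kernel R P M"
    using F G BP by (intro tensor_kernel_sum[OF P M] tensor_kernel_diff_right[OF P M] mn) auto
  from tensor_kernel_add[OF P M this tensor_kernel_diff[OF P M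
      pad[OF tF _ F(4)] pad[OF uG _ G(4)]]]
  have "(t - u) - (\<Sum>b\<in>F \<union> G. frag_of (b, m b \<ominus>\<^bsub>M\<^esub> n b)) \<in> tensor_kernel R P M"
    by (simp add: sum_subtractf sum.distrib algebra_simps)
  moreover have "m b \<ominus>\<^bsub>M\<^esub> n b = \<zero>\<^bsub>M\<^esub>" if "b \<notin> F \<union> G" for b
    using that F(4) G(4) by (simp add: M.minus_eq)
  ultimately show ?case
    using F(1,2) G(1,2) mn by (intro exI[of _ "F \<union> G"] exI[of _ "\<lambda>b. m b \<ominus>\<^bsub>M\<^esub> n b"]) auto
next
  case (generator z)
  interpret P: module R P by fact
  interpret M: module R M by fact
  have BP: "B \<subseteq> carrier P" using B by (simp add: module_basis_def)
  obtain p x where z: "z = (p, x)" "p \<in> carrier P" "x \<in> carrier M" using generator by auto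
  obtain F c where F: "finite F" "F \<subseteq> B" "c \<in> F \<rightarrow> carrier R" "p = (\<Oplus>\<^bsub>P\<^esub>b\<in>F. c b \<odot>\<^bsub>P\<^esub> b)"
    using B z(2) unfolding module_basis_def by blast
  let ?m = "\<lambda>b. if b \<in> F then c b \<odot>\<^bsub>M\<^esub> x else \<zero>\<^bsub>M\<^esub>"
  have "F \<subseteq> carrier P" using F BP by blast
  from tensor_kernel_expand_left[OF P M z(3) F(1) this F(3)]
  have "frag_of z - (\<Sum>b\<in>F. frag_of (b, ?m b)) \<in> tensor_kernel R P M"
    unfolding z(1) F(4) by simp
  then show ?case
    using F z by (intro exI[of _ F] exI[of _ ?m]) (auto intro!: M.smult_closed)
qed

text \<open>Normal forms are unique: if \<open>\<kappa>\<close> is the coordinate function of the basis element \<open>a\<close>, the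
  balanced map \<open>(p, x) \<mapsto> \<kappa> p x\<close> sends the sum to \<open>m a\<close>.\<close>

lemma tensor_kernel_basis_sum:
  assumes P: "module R P" and M: "module R M" and B: "module_basis R P B"
    and F: "finite F" "F \<subseteq> B" and m: "m \<in> F \<rightarrow> carrier M"
    and ker: "(\<Sum>b\<in>F. frag_of (b, m b)) \<in> tensor_kernel R P M" and a: "a \<in> F"
  shows "m a = \<zero>\<^bsub>M\<^esub>"
proof -
  interpret P: module R P by fact
  interpret M: module R M by fact
  have BP: "B \<subseteq> carrier P" using B by (simp add: module_basis_def)
  obtain \<kappa> where \<kappa>: "\<And>b x. x \<in> carrier P \<Longrightarrow> \<kappa> b x \<in> carrier R"
    "\<And>b x y. x \<in> carrier P \<Longrightarrow> y \<in> carrier P \<Longrightarrow> \<kappa> b (x \<oplus>\<^bsub>P\<^esub> y) = \<kappa> b x \<oplus>\<^bsub>R\<^esub> \<kappa> b y"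
    "\<And>b a x. a \<in> carrier R \<Longrightarrow> x \<in> carrier P \<Longrightarrow> \<kappa> b (a \<odot>\<^bsub>P\<^esub> x) = a \<otimes>\<^bsub>R\<^esub> \<kappa> b x"
    "\<And>b b'. b' \<in> B \<Longrightarrow> \<kappa> b b' = (if b = b' then \<one>\<^bsub>R\<^esub> else \<zero>\<^bsub>R\<^esub>)"
    using basis_coordinate_functions[OF P B] by blast
  have comm: "comm_group (add_monoid M)" by (rule M.a_comm_group)
  obtain h where h: "h \<in> hom (free_Abelian_group (carrier P \<times> carrier M)) (add_monoid M)"
    and gen: "\<And>p x. p \<in> carrier P \<Longrightarrow> x \<in> carrier M \<Longrightarrow> h (frag_of (p, x)) = \<kappa> a p \<odot>\<^bsub>M\<^esub> x"
    and kill: "\<And>t. t \<in> tensor_kernel R P M \<Longrightarrow> h t = \<one>\<^bsub>add_monoid M\<^esub>"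
    using balanced_map_hom[OF comm P M, of "\<lambda>p x. \<kappa> a p \<odot>\<^bsub>M\<^esub> x"]
    by (auto simp: \<kappa> M.smult_l_distr M.smult_r_distr M.smult_assoc1[symmetric] P.R.m_comm)
  have "h (\<Sum>b\<in>G. frag_of (b, m b)) = (if a \<in> G then m a else \<zero>\<^bsub>M\<^esub>)" if "finite G" "G \<subseteq> F" for G
    using that
  proof (induction G)
    case empty
    then show ?case using kill[OF tensor_kernel_zero[OF P M]] by simp
  next
    case (insert b G)
    have b: "b \<in> B" "b \<in> carrier P" "m b \<in> carrier M" using insert.prems F BP m by auto
    have carr: "frag_of (b, m b) \<in> carrier (free_Abelian_group (carrier P \<times> carrier M))"
      "(\<Sum>b\<in>G. frag_of (b, m b)) \<in> carrier (free_Abelian_group (carrier P \<times> carrier M))"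
    proof -
      show "(\<Sum>b\<in>G. frag_of (b, m b)) \<in> carrier (free_Abelian_group (carrier P \<times> carrier M))"
        using insert.prems F BP m by (intro sum_closed_free_Abelian_group) auto
    qed (use b in simp)
    have ma: "m a \<in> carrier M" using a m by auto
    have "h (\<Sum>b\<in>insert b G. frag_of (b, m b)) =
        h (frag_of (b, m b)) \<oplus>\<^bsub>M\<^esub> h (\<Sum>b\<in>G. frag_of (b, m b))"
      using hom_mult[OF h carr] insert.hyps by simp
    also have "\<dots> = (if a = b then m b else \<zero>\<^bsub>M\<^esub>) \<oplus>\<^bsub>M\<^esub> (if a \<in> G then m a else \<zero>\<^bsub>M\<^esub>)"
      using insert b by (simp add: gen \<kappa>)
    finally show ?case using insert.hyps ma by auto
  qed
  from this[OF F(1)] show ?thesis using kill[OF ker] a by simp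
qed

text \<open>The map induced by \<open>f\<close> sends the normal form with entries \<open>m b\<close> to the one with entries
  \<open>f (m b)\<close>. If the latter is zero, uniqueness of normal forms gives \<open>f (m b) = 0\<close>, hence
  \<open>m b = 0\<close> for all \<open>b\<close>.\<close>

lemma free_imp_flat:
  assumes "free_module R P"
  shows "flat_module TYPE('u) R P"
proof -
  have P: "module R P" using assms by (simp add: free_module_def)
  obtain B where B: "module_basis R P B" using assms by (auto simp: free_module_def)
  have BP: "B \<subseteq> carrier P" using B by (simp add: module_basis_def)
  show ?thesis
    unfolding flat_module_def
  proof (intro conjI allI impI P)
    fix M N :: "('a, 'a + 'u) module" and f
    assume *: "module R M \<and> module R N \<and> f \<in> linear_maps R M N \<and> inj_on f (carrier M)"
    then have M: "module R M" and N: "module R N" and f: "f \<in> linear_maps R M N"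
      and inj: "inj_on f (carrier M)" by auto
    interpret M: module R M by fact
    interpret N: module R N by fact
    let ?\<phi> = "frag_extend (\<lambda>(p, x). frag_of (p, f x))"
    have fM: "f x \<in> carrier N" if "x \<in> carrier M" for x using f that by (auto simp: linear_maps_def)
    have f0: "f \<zero>\<^bsub>M\<^esub> = \<zero>\<^bsub>N\<^esub>"
    proof -
      have "f (\<zero>\<^bsub>R\<^esub> \<odot>\<^bsub>M\<^esub> \<zero>\<^bsub>M\<^esub>) = \<zero>\<^bsub>R\<^esub> \<odot>\<^bsub>N\<^esub> f \<zero>\<^bsub>M\<^esub>"
        using f M.zero_closed M.R.zero_closed unfolding linear_maps_def by blast
      then show ?thesis using fM[of "\<zero>\<^bsub>M\<^esub>"] by simp
    qed
    show "inj_on (tensor_map R P M N f) (carrier (tensor_product R P M))"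
      unfolding tensor_map_inj_iff[OF M N f P]
    proof (intro allI impI)
      fix t assume t: "Poly_Mapping.keys t \<subseteq> carrier P \<times> carrier M" and ker: "?\<phi> t \<in> tensor_kernel R P N"
      obtain F m where F: "finite F" "F \<subseteq> B" and m: "m \<in> UNIV \<rightarrow> carrier M"
        and tF: "t - (\<Sum>b\<in>F. frag_of (b, m b)) \<in> tensor_kernel R P M"
        using tensor_normal_form[OF P M B t] by blast
      have "?\<phi> t - (\<Sum>b\<in>F. frag_of (b, f (m b))) \<in> tensor_kernel R P N"
        using tensor_kernel_map[OF M N f P tF] F(1) by (simp add: frag_extend_diff frag_extend_sum)
      from tensor_kernel_diff[OF P N ker this]
      have sum: "(\<Sum>b\<in>F. frag_of (b, f (m b))) \<in> tensor_kernel R P N" by simp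
      have "m b = \<zero>\<^bsub>M\<^esub>" if "b \<in> F" for b
      proof -
        have "f (m b) = \<zero>\<^bsub>N\<^esub>"
          using tensor_kernel_basis_sum[OF P N B F _ sum that] m fM by auto
        then show ?thesis using inj f0 m by (auto dest!: inj_onD[of f _ "m b" "\<zero>\<^bsub>M\<^esub>"])
      qed
      then have "(\<Sum>b\<in>F. frag_of (b, m b)) \<in> tensor_kernel R P M"
        using F BP by (intro tensor_kernel_sum[OF P M]) (auto intro!: tensor_kernel_zero_right[OF P M])
      from tensor_kernel_add[OF P M tF this] show "t \<in> tensor_kernel R P M" by simp
    qed
  qed
qed


section \<open>Flatness forces unique decompositions\<close>

text \<open>At a minimal exponent \<open>w\<close>, the only contribution to a product comes from the constant term of
  the scalar. So taking the coefficient at \<open>w\<close> is linear over \<open>\<kappa>[S]\<close>, which acts on \<open>\<kappa>\<close> through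
  constant terms.\<close>

lemma lookup_mult_apery:
  fixes a f :: "'s::comm_monoid_add \<Rightarrow>\<^sub>0 'k::field"
  assumes a: "Poly_Mapping.keys a \<subseteq> S" and f: "Poly_Mapping.keys f \<subseteq> J" and w: "w \<in> apery_set S J"
  shows "Poly_Mapping.lookup (a * f) w = Poly_Mapping.lookup a 0 * Poly_Mapping.lookup f w"
proof -
  have "Poly_Mapping.lookup (a * f) (0 + w) = Poly_Mapping.lookup a 0 * Poly_Mapping.lookup f w"
  proof (rule lookup_mult_sole_pair)
    fix s t assume st: "s \<in> Poly_Mapping.keys a" "t \<in> Poly_Mapping.keys f" "s + t = 0 + w"
    then have "s \<in> S" "t \<in> J" "w = s + t" using a f by auto
    then have "s = 0" using w unfolding apery_set_def by blast
    then show "s = 0 \<and> t = w" using st by simp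
  qed
  then show ?thesis by simp
qed

text \<open>The hypothesis \<open>s1 + w1 = s2 + w2\<close> is a linear relation over \<open>\<kappa>[S]\<close> between the monomials of
  exponents \<open>w1\<close> and \<open>w2\<close>. Flatness is applied to the inclusion of the ideal
  generated by the monomials of exponents \<open>s1\<close> and \<open>s2\<close> into \<open>\<kappa>[S]\<close>; the set \<open>J\<close> below
  consists of the exponents of this ideal.\<close>

lemma flat_imp_dvd:
  fixes S T :: "'s::comm_monoid_add set"
  assumes T: "affine_semigroup T" "positive_monoid T" and S: "add_submonoid S" "S \<subseteq> T"
    and flat: "flat_module TYPE('u) (monoid_ring S :: ('s \<Rightarrow>\<^sub>0 'k::field) ring) (ring_as_module (monoid_ring T))"
    and s: "s1 \<in> S" "s2 \<in> S" and w: "w1 \<in> apery_set S T" "w2 \<in> T"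
    and eq: "s1 + w1 = s2 + w2"
  shows "\<exists>t\<in>S. s1 = s2 + t"
proof (rule ccontr)
  assume no: "\<not> ?thesis"
  let ?u = "\<lambda>s. Poly_Mapping.single s (1::'k)"
  let ?l = Poly_Mapping.lookup
  let ?R = "monoid_ring S :: ('s \<Rightarrow>\<^sub>0 'k) ring"
  let ?P = "ring_as_module (monoid_ring T :: ('s \<Rightarrow>\<^sub>0 'k) ring)"
  define J where "J = {s1 + t |t. t \<in> S} \<union> {s2 + t |t. t \<in> S}"
  let ?M = "monomial_span_module J :: ('s \<Rightarrow>\<^sub>0 'k, ('s \<Rightarrow>\<^sub>0 'k) + 'u) module"
  let ?N = "monomial_span_module S :: ('s \<Rightarrow>\<^sub>0 'k, ('s \<Rightarrow>\<^sub>0 'k) + 'u) module"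
  have subT: "add_submonoid T" and cancel: "\<And>a x y. a \<in> T \<Longrightarrow> x \<in> T \<Longrightarrow> y \<in> T \<Longrightarrow> a + x = a + y \<Longrightarrow> x = y"
    using T unfolding affine_semigroup_def by blast+
  have zeroS: "0 \<in> S" and addS: "\<And>x y. x \<in> S \<Longrightarrow> y \<in> S \<Longrightarrow> x + y \<in> S"
    using S(1) by (auto simp: add_submonoid_def)
  have unit: "x = 0" if "x \<in> S" "y \<in> S" "x + y = 0" for x y
    using T(2) S(2) that unfolding positive_monoid_def by blast
  have JS: "J \<subseteq> S" unfolding J_def using s addS by auto
  have SJ: "s + j \<in> J" if "s \<in> S" "j \<in> J" for s j
  proof -
    from \<open>j \<in> J\<close> obtain t where "t \<in> S" "j = s1 + t \<or> j = s2 + t" unfolding J_def by blast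
    then have "s + t \<in> S" "s + j = s1 + (s + t) \<or> s + j = s2 + (s + t)"
      using addS that(1) by (auto simp: add_ac)
    then show ?thesis unfolding J_def by blast
  qed
  have sJ: "s1 \<in> J" "s2 \<in> J" unfolding J_def using zeroS by force+
  \<comment> \<open>As \<open>s2\<close> does not divide \<open>s1\<close>, the exponent \<open>s1\<close> is a minimal generator of \<open>J\<close>; positivity
    excludes proper divisors of the form \<open>s1 + t\<close>.\<close>
  have s1_apery: "s1 \<in> apery_set S J"
  proof -
    have "s = 0" if "s \<in> S" "j \<in> J" "s1 = s + j" for s j
    proof -
      from \<open>j \<in> J\<close> obtain t where t: "t \<in> S" "j = s1 + t \<or> j = s2 + t" unfolding J_def by blast
      then have "s + t \<in> S" using addS that(1) by blast
      moreover have "s1 = s1 + (s + t) \<or> s1 = s2 + (s + t)"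
        using t(2) that(3) by (metis add.left_commute)
      ultimately have "s1 + (s + t) = s1 + 0" using no by auto
      then have "s + t = 0" using cancel[of s1 "s + t" 0] \<open>s + t \<in> S\<close> zeroS s S(2) by blast
      then show "s = 0" using unit t(1) that(1) by blast
    qed
    then show ?thesis using sJ unfolding apery_set_def by blast
  qed
  have w1T: "w1 \<in> T" using w by (simp add: apery_set_def)
  have P: "module ?R ?P" by (rule module_monoid_ring[OF S(1) subT S(2)])
  have M: "module ?R ?M" by (rule module_monomial_span[OF S(1) SJ])
  have N: "module ?R ?N" by (rule module_monomial_span[OF S(1) addS])
  have f: "id \<in> linear_maps ?R ?M ?N"
    using JS by (auto simp: linear_maps_def)
  have inj: "inj_on (tensor_map ?R ?P ?M ?N id) (carrier (tensor_product ?R ?P ?M))"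
    using flat M N f inj_on_id[of "carrier ?M"] unfolding flat_module_def by blast
  let ?t = "frag_of (?u w1, Inl (?u s1)) - frag_of (?u w2, Inl (?u s2)) :: _ \<Rightarrow>\<^sub>0 int"
  have keys: "Poly_Mapping.keys ?t \<subseteq> carrier ?P \<times> carrier ?M"
    using w1T w(2) sJ by (auto dest!: subsetD[OF keys_diff])
  \<comment> \<open>Over \<open>?N\<close>, the monomial of exponent \<open>s\<close> is a multiple of 1 and moves to the left factor,
    where both terms become the monomial of exponent \<open>s1 + w1 = s2 + w2\<close>.\<close>
  have "?t \<in> tensor_kernel ?R ?P ?N"
  proof -
    have one: "frag_of (?u (s + w), Inl 1) - frag_of (?u w, Inl (?u s)) \<in> tensor_kernel ?R ?P ?N"
      if "s \<in> S" "w \<in> T" for s w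
      using tensor_kernel_smult[of "Inl 1" ?N "?u w" ?P "?u s" ?R] that zeroS
      by (simp add: mult_single)
    from tensor_kernel_diff[OF P N one[OF s(2) w(2)] one[OF s(1) w1T]]
    show ?thesis by (simp add: eq)
  qed
  moreover have "frag_extend (\<lambda>(p, x). frag_of (p, id x)) ?t = ?t"
    by (simp add: frag_extend_diff)
  ultimately have ker: "?t \<in> tensor_kernel ?R ?P ?M"
    using inj keys unfolding tensor_map_inj_iff[OF M N f P] by metis
  let ?A = "\<lparr>carrier = UNIV :: 'k set, monoid.mult = (+), one = 0\<rparr>"
  have A: "comm_group ?A"
    by (rule comm_groupI) (auto simp: add_ac intro!: exI[of _ "- _"])
  \<comment> \<open>Coefficient at \<open>w1\<close> times coefficient at \<open>s1\<close>: both factors are taken at minimal exponents,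
    so a scalar can be moved across.\<close>
  obtain h where h: "h \<in> hom (free_Abelian_group (carrier ?P \<times> carrier ?M)) ?A"
    and gen: "\<And>p x. p \<in> carrier ?P \<Longrightarrow> x \<in> carrier ?M \<Longrightarrow> h (frag_of (p, x)) = ?l p w1 * ?l (projl x) s1"
    and kill: "\<And>t. t \<in> tensor_kernel ?R ?P ?M \<Longrightarrow> h t = \<one>\<^bsub>?A\<^esub>"
  proof (rule balanced_map_hom[OF A P M, of "\<lambda>p x. ?l p w1 * ?l (projl x) s1"])
    fix a p x assume "a \<in> carrier ?R" "p \<in> carrier ?P" "x \<in> carrier ?M"
    then show "?l (a \<odot>\<^bsub>?P\<^esub> p) w1 * ?l (projl x) s1 = ?l p w1 * ?l (projl (a \<odot>\<^bsub>?M\<^esub> x)) s1"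
      using lookup_mult_apery[OF _ _ w(1), of a p] lookup_mult_apery[OF _ _ s1_apery, of a "projl x"]
      by auto
  qed (auto simp: lookup_add algebra_simps)
  have "s1 \<noteq> s2" using no zeroS by force
  have "frag_of (?u w1, Inl (?u s1)) = ?t + frag_of (?u w2, Inl (?u s2))" by simp
  then have "h (frag_of (?u w1, Inl (?u s1))) = h ?t + h (frag_of (?u w2, Inl (?u s2)))"
    using hom_mult[OF h, of ?t "frag_of (?u w2, Inl (?u s2))"] keys w(2) sJ by simp
  then show False
    using kill[OF ker] gen w1T w(2) sJ \<open>s1 \<noteq> s2\<close> by (simp add: lookup_single)
qed

lemma flat_imp_unique_apery_decompositions:
  fixes S T :: "'s::comm_monoid_add set"
  assumes T: "affine_semigroup T" "positive_monoid T" and S: "add_submonoid S" "S \<subseteq> T"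
    and flat: "flat_module TYPE('u) (monoid_ring S :: ('s \<Rightarrow>\<^sub>0 'k::field) ring) (ring_as_module (monoid_ring T))"
  shows "unique_apery_decompositions S T"
  unfolding unique_apery_decompositions_def
proof (intro ballI impI)
  fix s1 s2 w1 w2
  assume s: "s1 \<in> S" "s2 \<in> S" and w: "w1 \<in> apery_set S T" "w2 \<in> apery_set S T"
    and eq: "s1 + w1 = s2 + w2"
  have wT: "w1 \<in> T" "w2 \<in> T" using w by (auto simp: apery_set_def)
  obtain t where t: "t \<in> S" "s1 = s2 + t"
    using flat_imp_dvd[OF T S flat s w(1) wT(2) eq] by blast
  have "t + w1 \<in> T"
  proof -
    have "add_submonoid T" using T by (simp add: affine_semigroup_def)
    then show ?thesis using t(1) S(2) wT by (auto simp: add_submonoid_def)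
  qed
  moreover have "s2 + (t + w1) = s2 + w2" using eq t by (simp add: add_ac)
  ultimately have w2: "w2 = t + w1"
    using T(1) s S(2) wT unfolding affine_semigroup_def by (metis subsetD)
  then have "t = 0" using w(2) t(1) wT unfolding apery_set_def by blast
  then show "s1 = s2 \<and> w1 = w2" using t(2) w2 by simp
qed

theorem theorem4p3:
  fixes S S' :: "'s::comm_monoid_add set"
    and R R' :: "('s \<Rightarrow>\<^sub>0 'k::field) ring"
  assumes "affine_semigroup S'" and "positive_monoid S'"
    and "affine_semigroup S" and "S \<subseteq> S'"
    and "R = monoid_ring S" and "R' = monoid_ring S'"
  shows "((\<forall>x \<in> (monomials S' :: ('s \<Rightarrow>\<^sub>0 'k) set). \<exists>!r. is_representation S S' x r)
            \<longleftrightarrow> free_module R (ring_as_module R'))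
       \<and> (free_module R (ring_as_module R')
            \<longleftrightarrow> flat_module TYPE('u) R (ring_as_module R'))"
proof -
  have S: "add_submonoid S" and S': "add_submonoid S'"
    using assms by (simp_all add: affine_semigroup_def)
  have "free_module R (ring_as_module R')" if "unique_apery_decompositions S S'"
    unfolding free_module_def assms(5,6)
    using module_monoid_ring[OF S S' assms(4)] apery_monomials_basis[OF assms(1,2) S assms(4) that]
    by blast
  moreover have "flat_module TYPE('u) R (ring_as_module R')" if "free_module R (ring_as_module R')"
    using that by (rule free_imp_flat)
  moreover have "unique_apery_decompositions S S'" if "flat_module TYPE('u) R (ring_as_module R')"
    using flat_imp_unique_apery_decompositions[OF assms(1,2) S assms(4)] that
    unfolding assms(5,6) .
  ultimately show ?thesis
    unfolding unique_representation_iff[OF assms(1,2) S assms(4)] by blast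
qed

end
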